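(* Let $\epsilon>0$ be a constant. Consider single-pass streaming algorithms whose input is an unweighted (multi)graph $G=(V,E)$ with $|V|=n$ and $|E|=m$, given as a stream of the edges of $G$ in uniformly random order. Any such algorithm that outputs a $(2-\epsilon)$-approximation to the value of the maximum cut in $G$ with probability at least $99/100$ (over its internal randomness) must use $\tilde\Omega(\sqrt{n})$ space.
   Context: The maximum cut value of $G=(V,E)$ is $\mathrm{OPT}=\max_{P\cup Q=V,\,P\cap Q=\emptyset}|E\cap(P\times Q)|$, where edges are counted with multiplicity. An algorithm outputs a $\gamma$-approximation (for $\gamma\ge 1$) if its output lies in $[\mathrm{OPT}/\gamma,\mathrm{OPT}]$. "Random order" means the edges (a multiset) arrive in an order given by a uniformly random permutation. Space is measured in bits. $\tilde\Omega(\cdot)$ hides factors polylogarithmic in $n$. *)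

theory Defs
  imports "HOL-Probability.Probability" "HOL-Combinatorics.Combinatorics"
begin

section \<open>Maximum cut of a multigraph\<close>

text \<open>
  The vertex set of a graph on \<open>n\<close> vertices is \<open>{..<n}\<close>. Edges are unordered pairs of distinct
  vertices, and a multigraph is the multiset of its edges: parallel edges are allowed, loops are not.
\<close>

definition edges :: "nat \<Rightarrow> nat set set" where
  "edges n = {{u, v} |u v. u < n \<and> v < n \<and> u \<noteq> v}"

definition multigraphs :: "nat \<Rightarrow> nat \<Rightarrow> nat set multiset set" where
  "multigraphs n m = {E. set_mset E \<subseteq> edges n \<and> size E = m}"

definition cut_value :: "nat set multiset \<Rightarrow> nat set \<Rightarrow> nat set \<Rightarrow> nat" where
  "cut_value E P Q = size {#e \<in># E. \<exists>p\<in>P. \<exists>q\<in>Q. e = {p, q}#}"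

definition max_cut :: "nat \<Rightarrow> nat set multiset \<Rightarrow> nat" where
  "max_cut n E = Max {cut_value E P Q |P Q. P \<union> Q = {..<n} \<and> P \<inter> Q = {}}"

definition approximates :: "real \<Rightarrow> real \<Rightarrow> real \<Rightarrow> bool" where
  "approximates \<gamma> opt x \<longleftrightarrow> opt / \<gamma> \<le> x \<and> x \<le> opt"


section \<open>Random-order streams\<close>

text \<open>
  Uniform distribution on the arrangements of a multiset; by lemma \<open>random_order_mset\<close> below this is
  the law of the stream obtained by applying a uniformly random permutation to any listing of it.
\<close>

definition random_order :: "'e multiset \<Rightarrow> 'e list pmf" where
  "random_order E = pmf_of_set (permutations_of_multiset E)"

lemma random_order_mset:
  "random_order (mset es) =
     map_pmf (\<lambda>\<pi>. permute_list \<pi> es) (pmf_of_set {\<pi>. \<pi> permutes {..<length es}})"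
proof -
  define l where "l = length es"
  define S where "S = {\<pi>. \<pi> permutes {..<l}}"
  define A where "A = permutations_of_multiset (mset es)"
  define \<mu> where "\<mu> = map_pmf (\<lambda>\<pi>. permute_list \<pi> es) (pmf_of_set S)"
  have finS: "finite S" unfolding S_def by (rule finite_permutations) simp
  have neS: "S \<noteq> {}" unfolding S_def using permutes_id by blast
  have finA: "finite A" and neA: "A \<noteq> {}"
    unfolding A_def by simp_all
  have supp: "set_pmf \<mu> \<subseteq> A"
    using finS neS by (auto simp: \<mu>_def A_def S_def l_def permutations_of_multiset_def)
  have const: "pmf \<mu> ys = pmf \<mu> es" if ys: "ys \<in> A" for ys
  proof -
    have "mset ys = mset es" using ys by (auto simp: A_def permutations_of_multiset_def)
    then obtain \<sigma> where \<sigma>: "\<sigma> permutes {..<l}" "permute_list \<sigma> es = ys"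
      unfolding l_def by (rule mset_eq_permutation)
    have bij: "bij_betw (\<lambda>\<pi>. \<pi> \<circ> \<sigma>) S S"
      unfolding S_def bij_betw_def
    proof
      show "inj_on (\<lambda>\<pi>. \<pi> \<circ> \<sigma>) {\<pi>. \<pi> permutes {..<l}}"
      proof (rule inj_onI)
        fix f g assume "f \<circ> \<sigma> = g \<circ> \<sigma>"
        then have "f \<circ> \<sigma> \<circ> inv \<sigma> = g \<circ> \<sigma> \<circ> inv \<sigma>" by simp
        then show "f = g" using permutes_inv_o(1)[OF \<sigma>(1)] by (simp add: comp_assoc)
      qed
      show "(\<lambda>\<pi>. \<pi> \<circ> \<sigma>) ` {\<pi>. \<pi> permutes {..<l}} = {\<pi>. \<pi> permutes {..<l}}"
      proof (intro equalityI subsetI)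
        fix f assume "f \<in> {\<pi>. \<pi> permutes {..<l}}"
        then have "f = (f \<circ> inv \<sigma>) \<circ> \<sigma>" "(f \<circ> inv \<sigma>) permutes {..<l}"
          using permutes_inv_o(2)[OF \<sigma>(1)] \<sigma>(1)
          by (auto simp: comp_assoc intro: permutes_compose permutes_inv)
        then show "f \<in> (\<lambda>\<pi>. \<pi> \<circ> \<sigma>) ` {\<pi>. \<pi> permutes {..<l}}" by blast
      qed (use \<sigma>(1) in \<open>auto intro: permutes_compose\<close>)
    qed
    have "\<mu> = map_pmf (\<lambda>\<pi>. permute_list \<pi> es) (map_pmf (\<lambda>\<pi>. \<pi> \<circ> \<sigma>) (pmf_of_set S))"
      unfolding \<mu>_def using map_pmf_of_set_bij_betw[OF bij neS finS] by simp
    also have "\<dots> = map_pmf (permute_list \<sigma>) \<mu>"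
      unfolding \<mu>_def pmf.map_comp
      by (intro map_pmf_cong refl) (use \<sigma>(1) in \<open>auto simp: l_def permute_list_compose\<close>)
    finally have eq: "\<mu> = map_pmf (permute_list \<sigma>) \<mu>" .
    have inj: "inj_on (permute_list \<sigma>) A"
    proof (rule inj_onI)
      fix xs zs assume *: "xs \<in> A" "zs \<in> A" "permute_list \<sigma> xs = permute_list \<sigma> zs"
      have len: "length xs = l" "length zs = l"
        using *(1,2) by (auto simp: A_def l_def permutations_of_multiset_def dest: mset_eq_length)
      have "permute_list (inv \<sigma>) (permute_list \<sigma> as) = as" if "length as = l" for as :: "'a list"
        using permute_list_compose[of "inv \<sigma>" as \<sigma>] permutes_inv[OF \<sigma>(1)] that
          permutes_inv_o(1)[OF \<sigma>(1)] by (simp flip: permute_list_compose)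
      then show "xs = zs" using * len by metis
    qed
    have esA: "es \<in> A" by (simp add: A_def permutations_of_multiset_def)
    have "pmf \<mu> ys = pmf (map_pmf (permute_list \<sigma>) \<mu>) (permute_list \<sigma> es)"
      using eq \<sigma>(2) by simp
    also have "\<dots> = measure_pmf.prob \<mu> (permute_list \<sigma> -` {permute_list \<sigma> es} \<inter> set_pmf \<mu>)"
      by (simp add: pmf_map measure_Int_set_pmf)
    also have "permute_list \<sigma> -` {permute_list \<sigma> es} \<inter> set_pmf \<mu> = {es} \<inter> set_pmf \<mu>"
      using inj supp esA by (auto dest: inj_onD)
    also have "measure_pmf.prob \<mu> ({es} \<inter> set_pmf \<mu>) = pmf \<mu> es"
      by (simp add: measure_Int_set_pmf measure_pmf_single)
    finally show ?thesis .
  qed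
  have "(\<Sum>ys\<in>A. pmf \<mu> ys) = 1" using sum_pmf_eq_1[OF finA supp] .
  then have "real (card A) * pmf \<mu> es = 1" using const by simp
  then have val: "pmf \<mu> es = 1 / card A" using finA neA by (simp add: field_simps)
  have "pmf_of_set A = \<mu>"
  proof (rule pmf_eqI)
    fix ys
    show "pmf (pmf_of_set A) ys = pmf \<mu> ys"
      using const[of ys] val supp finA neA
      by (cases "ys \<in> A") (auto simp: pmf_of_set set_pmf_iff)
  qed
  then show ?thesis by (simp add: random_order_def \<mu>_def A_def S_def l_def)
qed


section \<open>Streaming algorithms\<close>

text \<open>
  A deterministic single-pass algorithm is given by its initial memory contents (a bit string), the
  update of the memory on the arrival of an edge, and the value read off from the final memory. The
  update may depend, free of charge, on the position of the edge in the stream.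

  A randomized algorithm is a distribution over deterministic ones. Because updates may depend on
  the position, this covers algorithms that toss fresh coins at every step; randomness is not
  charged for.
\<close>

record 'e stream_alg =
  initial :: "bool list"
  update :: "nat \<Rightarrow> bool list \<Rightarrow> 'e \<Rightarrow> bool list"
  result :: "bool list \<Rightarrow> real"

definition memory :: "'e stream_alg \<Rightarrow> 'e list \<Rightarrow> bool list" where
  "memory D es = fold (\<lambda>(i, e) w. update D i w e) (List.enumerate 0 es) (initial D)"

definition run :: "'e stream_alg \<Rightarrow> 'e list \<Rightarrow> real" where
  "run D es = result D (memory D es)"

text \<open>At no time during a stream of \<open>m\<close> edges on \<open>n\<close> vertices are more than \<open>s\<close> bits stored.\<close>

definition uses_space :: "nat \<Rightarrow> nat \<Rightarrow> nat \<Rightarrow> nat set stream_alg pmf \<Rightarrow> bool" where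
  "uses_space n m s A \<longleftrightarrow>
     (\<forall>D\<in>set_pmf A. \<forall>es. set es \<subseteq> edges n \<and> length es \<le> m \<longrightarrow> length (memory D es) \<le> s)"

definition approximates_max_cut :: "real \<Rightarrow> nat \<Rightarrow> nat \<Rightarrow> nat set stream_alg pmf \<Rightarrow> bool" where
  "approximates_max_cut \<gamma> n m A \<longleftrightarrow>
     (\<forall>E\<in>multigraphs n m.
        measure_pmf.prob (pair_pmf A (random_order E))
          {(D, es). approximates \<gamma> (real (max_cut n E)) (run D es)} \<ge> 99/100)"

end

theory Submission
  imports Defs "HOL-Real_Asymp.Real_Asymp"
begin

text \<open>
  Consider streams of \<open>m = O(n)\<close> independent random edges, which are automatically in random order. The
  edges are either uniform, so that by a union bound no cut contains much more than half of them, or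
  uniform among the edges of a hidden random cut \<open>x\<close>, so that the maximum cut is \<open>m\<close>. A
  \<open>(2 - \<epsilon>)\<close>-approximation distinguishes the two cases.

  The Hellinger affinity of the two memory distributions decreases slowly. In one step it is
  enough to compare the pairs (old memory, new edge), and the loss is at most half the mean of
  \<open>(E[x\<^sub>i x\<^sub>j | memory])\<^sup>2\<close> over all pairs \<open>i < j\<close>. Given a memory content of probability at least
  \<open>2\<^sup>-\<^sup>r\<close>, the posterior density of \<open>x\<close> is at most \<open>2\<^sup>r\<close>, and the level-two inequality bounds the sum of
  these squares by \<open>8 r\<^sup>2\<close>. With \<open>s\<close> bits of memory the total loss is thus of order
  \<open>m s\<^sup>2 / n\<^sup>2\<close>, up to negligible terms, which is small unless \<open>s\<close> is of order \<open>\<surd>n\<close>.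
\<close>

section \<open>The level-two inequality on the cube\<close>

text \<open>Points of the sign cube are encoded as subsets of \<open>{..<h}\<close>; for uniform
  \<open>x\<close> the values \<open>rad x i\<close> with \<open>i < h\<close> are independent
  random signs.\<close>

definition rad :: "nat set \<Rightarrow> nat \<Rightarrow> real" where
  "rad x i = (if i \<in> x then -1 else 1)"

section \<open>Moments of sign polynomials of degree one and two\<close>

lemma sum_Pow_lessThan_Suc:
  fixes F :: "nat set \<Rightarrow> 'a::comm_monoid_add"
  shows "(\<Sum>x\<in>Pow {..<Suc h}. F x) = (\<Sum>x\<in>Pow {..<h}. F x + F (insert h x))"
proof -
  have "Pow {..<Suc h} = Pow {..<h} \<union> insert h ` Pow {..<h}"
    by (simp add: lessThan_Suc Pow_insert)
  moreover have "Pow {..<h} \<inter> insert h ` Pow {..<h} = {}" by auto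
  moreover have "inj_on (insert h) (Pow {..<h})"
    by (auto simp: inj_on_def)
  ultimately show ?thesis
    by (simp add: sum.union_disjoint sum.reindex sum.distrib)
qed

text \<open>Compare successive ratios: from \<open>j\<close> to \<open>Suc j\<close> the left side
  is multiplied by (2r-2j)(2r-2j-1) / ((2j+1)(2j+2)) and the right side by (r-j)(2r-1) / (j+1),
  which is no smaller.\<close>

lemma choose_even_le:
  fixes r j :: nat
  assumes "r \<ge> 1"
  shows "real (2 * r choose (2 * j)) \<le> real (r choose j) * (2 * real r - 1) ^ j"
proof (induction j)
  case (Suc j)
  show ?case
  proof (cases "Suc j \<le> r")
    case True
    have bs: "real (Suc k) * real (N choose Suc k) = (real N - real k) * real (N choose k)"
      if "k \<le> N" for N k
    proof -
      have "Suc k * (N choose Suc k) = (N - k) * (N choose k)"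
        by (metis binomial_absorption binomial_absorb_comp)
      then have "real (Suc k * (N choose Suc k)) = real ((N - k) * (N choose k))" by simp
      then show ?thesis using that by (simp only: of_nat_mult of_nat_diff)
    qed
    define c where "c = real (2 * r choose (2 * j))"
    have e1: "(2 * real j + 1) * real (2 * r choose Suc (2 * j)) = (2 * real r - 2 * real j) * c"
      using bs[of "2 * j" "2 * r"] True by (simp add: c_def algebra_simps)
    have e2: "(2 * real j + 2) * real (2 * r choose Suc (Suc (2 * j)))
        = (2 * real r - 2 * real j - 1) * real (2 * r choose Suc (2 * j))"
      using bs[of "Suc (2 * j)" "2 * r"] True by (simp add: algebra_simps)
    have e3: "(real j + 1) * real (r choose Suc j) = (real r - real j) * real (r choose j)"
      using bs[of j r] True by (simp add: algebra_simps)
    have "(2 * real j + 2) * ((2 * real j + 1) * real (2 * r choose Suc (Suc (2 * j))))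
        = (2 * real r - 2 * real j - 1) * ((2 * real r - 2 * real j) * c)"
      using e1 e2 by (metis mult.left_commute)
    also have "\<dots> \<le> (2 * real r - 1) * ((2 * real r - 2 * real j) * (real (r choose j) * (2 * real r - 1) ^ j))"
      by (intro mult_mono mult_nonneg_nonneg) (use Suc True in \<open>auto simp: c_def\<close>)
    also have "\<dots> = 2 * ((real r - real j) * real (r choose j)) * (2 * real r - 1) ^ Suc j"
      by (simp add: algebra_simps)
    also have "\<dots> = (2 * real j + 2) * (real (r choose Suc j) * (2 * real r - 1) ^ Suc j)"
      by (simp only: e3[symmetric]) (simp add: algebra_simps)
    finally have "(2 * real j + 1) * real (2 * r choose Suc (Suc (2 * j)))
        \<le> real (r choose Suc j) * (2 * real r - 1) ^ Suc j"
      by (subst (asm) mult_le_cancel_left_pos) auto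
    moreover have "real (2 * r choose Suc (Suc (2 * j))) \<le> (2 * real j + 1) * real (2 * r choose Suc (Suc (2 * j)))"
      by (simp add: distrib_right)
    ultimately show ?thesis by simp
  qed (simp add: binomial_eq_0)
qed simp

lemma even_binomial_sum:
  fixes u v :: real
  shows "(u + v) ^ (2 * r) + (u - v) ^ (2 * r)
     = 2 * (\<Sum>j\<le>r. real (2 * r choose (2 * j)) * (v\<^sup>2) ^ j * (u\<^sup>2) ^ (r - j))"
proof -
  have "(u + v) ^ (2 * r) + (u - v) ^ (2 * r)
      = (\<Sum>k\<le>2 * r. real (2 * r choose k) * (v ^ k + (- v) ^ k) * u ^ (2 * r - k))"
    using binomial_ring[of v u "2 * r"] binomial_ring[of "- v" u "2 * r"]
    by (simp add: add.commute sum.distrib[symmetric] algebra_simps)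
  also have "\<dots> = (\<Sum>k\<in>(\<lambda>j. 2 * j) ` {..r}. real (2 * r choose k) * (v ^ k + (- v) ^ k) * u ^ (2 * r - k))"
  proof (rule sum.mono_neutral_right)
    show "\<forall>k\<in>{..2 * r} - (\<lambda>j. 2 * j) ` {..r}. real (2 * r choose k) * (v ^ k + (- v) ^ k) * u ^ (2 * r - k) = 0"
    proof
      fix k assume k: "k \<in> {..2 * r} - (\<lambda>j. 2 * j) ` {..r}"
      have "odd k"
      proof
        assume "even k"
        then obtain j where "k = 2 * j" by blast
        then show False using k by auto
      qed
      then show "real (2 * r choose k) * (v ^ k + (- v) ^ k) * u ^ (2 * r - k) = 0" by simp
    qed
  qed auto
  also have "\<dots> = (\<Sum>j\<le>r. real (2 * r choose (2 * j)) * (v ^ (2 * j) + (- v) ^ (2 * j)) * u ^ (2 * r - 2 * j))"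
    by (subst sum.reindex) (auto simp: inj_on_def)
  also have "\<dots> = (\<Sum>j\<le>r. 2 * (real (2 * r choose (2 * j)) * (v\<^sup>2) ^ j * (u\<^sup>2) ^ (r - j)))"
    by (intro sum.cong refl) (simp add: power_mult[symmetric] diff_mult_distrib2)
  finally show ?thesis by (simp add: sum_distrib_left)
qed

text \<open>Term-by-term comparison of the binomial expansions. This is the two-point
  hypercontractive inequality from L2 to L(2r).\<close>

lemma two_point_moment_le:
  fixes u v :: real
  assumes "r \<ge> 1"
  shows "(u + v) ^ (2 * r) + (u - v) ^ (2 * r) \<le> 2 * (u\<^sup>2 + (2 * real r - 1) * v\<^sup>2) ^ r"
proof -
  have "(\<Sum>j\<le>r. real (2 * r choose (2 * j)) * (v\<^sup>2) ^ j * (u\<^sup>2) ^ (r - j))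
     \<le> (\<Sum>j\<le>r. (real (r choose j) * (2 * real r - 1) ^ j) * (v\<^sup>2) ^ j * (u\<^sup>2) ^ (r - j))"
    by (intro sum_mono mult_right_mono choose_even_le assms) auto
  also have "\<dots> = ((2 * real r - 1) * v\<^sup>2 + u\<^sup>2) ^ r"
    by (subst binomial_ring) (simp add: power_mult_distrib mult.assoc)
  finally show ?thesis unfolding even_binomial_sum by (simp add: add.commute)
qed

text \<open>Jensen for the r-th power with weights proportional to \<open>U\<close> and
  \<open>V\<close>. When these are the norms of the two functions, summing the bound gives
  Minkowski's inequality.\<close>

lemma power_add_le_weighted:
  fixes a b U V :: real
  assumes "a \<ge> 0" "b \<ge> 0" "U > 0" "V > 0" "r \<ge> 1"
  shows "(a + b) ^ r \<le> (U + V) ^ (r - 1) * (a ^ r / U ^ (r - 1) + b ^ r / V ^ (r - 1))"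
proof -
  define s where "s = U / (U + V)"
  have s: "0 < s" "s < 1" "1 - s = V / (U + V)" using assms by (auto simp: s_def field_simps)
  have pw: "c * (d / c) ^ r = d ^ r / c ^ (r - 1)" if "c \<noteq> 0" for c d :: real
    using that assms(5) by (cases r) (auto simp: power_divide)
  have conv: "convex_on {0..} (\<lambda>x::real. x ^ r)"
    by (rule convex_on_realI[where f' = "\<lambda>x. real r * x ^ (r - 1)"])
       (auto intro!: derivative_eq_intros mult_left_mono power_mono)
  have "(a + b) ^ r = (s * (a / s) + (1 - s) * (b / (1 - s))) ^ r" using s(1,2) by simp
  also have "\<dots> \<le> s * (a / s) ^ r + (1 - s) * (b / (1 - s)) ^ r"
    using convex_onD[OF conv, of "1 - s" "a / s" "b / (1 - s)"] s(1,2) assms by auto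
  also have "s * (a / s) ^ r = (U + V) ^ (r - 1) * (a ^ r / U ^ (r - 1))"
    using pw[of s a] assms(3,4) by (simp add: s_def power_divide mult.commute)
  also have "(1 - s) * (b / (1 - s)) ^ r = (U + V) ^ (r - 1) * (b ^ r / V ^ (r - 1))"
    using pw[of "1 - s" b] assms(3,4) by (simp add: s(3) power_divide mult.commute)
  finally show ?thesis by (simp add: distrib_left)
qed

text \<open>Minkowski's inequality in L^r without roots: \<open>N\<close> normalises the measure,
  and \<open>U\<close>, \<open>V\<close> bound the norms. If one of them is zero, the corresponding
  function vanishes on \<open>Y\<close>.\<close>

lemma Minkowski_sum_power:
  fixes f g :: "'a \<Rightarrow> real"
  assumes fin: "finite Y" and f: "\<And>y. y \<in> Y \<Longrightarrow> f y \<ge> 0" and g: "\<And>y. y \<in> Y \<Longrightarrow> g y \<ge> 0"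
    and U: "U \<ge> 0" "(\<Sum>y\<in>Y. f y ^ r) \<le> N * U ^ r"
    and V: "V \<ge> 0" "(\<Sum>y\<in>Y. g y ^ r) \<le> N * V ^ r"
    and r: "r \<ge> 1" 
  shows "(\<Sum>y\<in>Y. (f y + g y) ^ r) \<le> N * (U + V) ^ r"
proof -
  have zero: "\<forall>y\<in>Y. k y = 0" if "\<And>y. y \<in> Y \<Longrightarrow> k y \<ge> 0" "(\<Sum>y\<in>Y. k y ^ r) \<le> N * 0 ^ r" for k :: "'a \<Rightarrow> real"
  proof -
    have "(\<Sum>y\<in>Y. k y ^ r) = 0"
      using that r by (intro antisym sum_nonneg) (auto simp: power_0_left)
    then show ?thesis using that fin by (subst (asm) sum_nonneg_eq_0_iff) auto
  qed
  consider "U = 0" | "V = 0" | "U > 0" "V > 0" using U(1) V(1) by linarith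
  then show ?thesis
  proof cases
    case 1
    then show ?thesis using zero[of f] f U V by simp
  next
    case 2
    then show ?thesis using zero[of g] g U V by simp
  next
    case 3
    have p: "x * x ^ (r - 1) = x ^ r" for x :: real using r by (cases r) auto
    have "(\<Sum>y\<in>Y. (f y + g y) ^ r)
        \<le> (\<Sum>y\<in>Y. (U + V) ^ (r - 1) * (f y ^ r / U ^ (r - 1) + g y ^ r / V ^ (r - 1)))"
      by (intro sum_mono power_add_le_weighted f g 3 r)
    also have "\<dots> = (U + V) ^ (r - 1) * ((\<Sum>y\<in>Y. f y ^ r) / U ^ (r - 1) + (\<Sum>y\<in>Y. g y ^ r) / V ^ (r - 1))"
      unfolding sum_divide_distrib sum.distrib[symmetric] sum_distrib_left ..
    also have "\<dots> \<le> (U + V) ^ (r - 1) * (N * U ^ r / U ^ (r - 1) + N * V ^ r / V ^ (r - 1))"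
      using 3 U V by (intro mult_left_mono add_mono divide_right_mono) auto
    also have "\<dots> = N * (U + V) ^ r"
      using 3 by (simp add: p[symmetric] field_simps)
    finally show ?thesis .
  qed
qed

text \<open>Adding one coordinate: its sign turns \<open>F\<close> into u + v or u - v. The
  two-point inequality is applied for each \<open>x\<close>, then Minkowski to u^2 and (2r-1) v^2.
  \<open>U\<close> and \<open>V\<close> bound squared L(2r) norms.\<close>

lemma moment_step:
  fixes u v :: "nat set \<Rightarrow> real"
  assumes U: "U \<ge> 0" "(\<Sum>x\<in>Pow {..<h}. u x ^ (2 * r)) \<le> 2 ^ h * U ^ r"
    and V: "V \<ge> 0" "(\<Sum>x\<in>Pow {..<h}. v x ^ (2 * r)) \<le> 2 ^ h * V ^ r"
    and r: "r \<ge> 1"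
    and F: "\<And>x. x \<subseteq> {..<h} \<Longrightarrow> F x = u x + v x" "\<And>x. x \<subseteq> {..<h} \<Longrightarrow> F (insert h x) = u x - v x"
  shows "(\<Sum>x\<in>Pow {..<Suc h}. F x ^ (2 * r)) \<le> 2 ^ Suc h * (U + (2 * real r - 1) * V) ^ r"
proof -
  have r': "2 * real r - 1 \<ge> 0" using r by simp
  have "(\<Sum>x\<in>Pow {..<Suc h}. F x ^ (2 * r)) = (\<Sum>x\<in>Pow {..<h}. (u x + v x) ^ (2 * r) + (u x - v x) ^ (2 * r))"
    unfolding sum_Pow_lessThan_Suc by (intro sum.cong refl) (simp add: F)
  also have "\<dots> \<le> (\<Sum>x\<in>Pow {..<h}. 2 * ((u x)\<^sup>2 + (2 * real r - 1) * (v x)\<^sup>2) ^ r)"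
    by (intro sum_mono two_point_moment_le r)
  also have "\<dots> \<le> 2 * (2 ^ h * (U + (2 * real r - 1) * V) ^ r)"
    unfolding sum_distrib_left[symmetric]
  proof (intro mult_left_mono Minkowski_sum_power)
    show "(\<Sum>y\<in>Pow {..<h}. ((2 * real r - 1) * (v y)\<^sup>2) ^ r) \<le> 2 ^ h * ((2 * real r - 1) * V) ^ r"
      using mult_left_mono[OF V(2), of "(2 * real r - 1) ^ r"] r'
      by (simp add: power_mult_distrib power_mult[symmetric] sum_distrib_left mult_ac)
  qed (use U V r r' in \<open>auto simp: power_mult[symmetric]\<close>)
  finally show ?thesis by simp
qed

definition rad_linear :: "(nat \<Rightarrow> real) \<Rightarrow> nat \<Rightarrow> nat set \<Rightarrow> real" where
  "rad_linear a h x = (\<Sum>i<h. a i * rad x i)"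

text \<open>Grouping the monomials by their larger index makes the last coordinate multiply a linear
  form in the earlier ones, which suits induction on \<open>h\<close>.\<close>

definition rad_quadratic :: "(nat \<Rightarrow> nat \<Rightarrow> real) \<Rightarrow> nat \<Rightarrow> nat set \<Rightarrow> real" where
  "rad_quadratic a h x = (\<Sum>j<h. rad x j * rad_linear (a j) j x)"

lemma rad_insert: "i \<noteq> h \<Longrightarrow> rad (insert h x) i = rad x i"
  by (simp add: rad_def)

lemma rad_linear_insert: "j \<le> h \<Longrightarrow> rad_linear a j (insert h x) = rad_linear a j x"
  unfolding rad_linear_def by (intro sum.cong refl) (auto simp: rad_insert)

lemma rad_quadratic_insert: "rad_quadratic a h (insert h x) = rad_quadratic a h x"
  unfolding rad_quadratic_def by (intro sum.cong refl) (auto simp: rad_insert rad_linear_insert)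

text \<open>Each new sign has the constant coefficient \<open>a h\<close>, so
  \<open>moment_step\<close> adds its square. This is Khintchine's inequality for even
  moments.\<close>

lemma rad_linear_moment_le:
  assumes "r \<ge> 1"
  shows "(\<Sum>x\<in>Pow {..<h}. rad_linear a h x ^ (2 * r)) \<le> 2 ^ h * ((2 * real r - 1) * (\<Sum>i<h. (a i)\<^sup>2)) ^ r"
proof (induction h)
  case 0
  then show ?case using assms by (simp add: rad_linear_def power_0_left)
next
  case (Suc h)
  have "(\<Sum>x\<in>Pow {..<Suc h}. rad_linear a (Suc h) x ^ (2 * r))
      \<le> 2 ^ Suc h * ((2 * real r - 1) * (\<Sum>i<h. (a i)\<^sup>2) + (2 * real r - 1) * (a h)\<^sup>2) ^ r"
  proof (rule moment_step[OF _ Suc, where v = "\<lambda>_. a h"])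
    show "rad_linear a (Suc h) x = rad_linear a h x + a h" if "x \<subseteq> {..<h}" for x
      using that by (auto simp: rad_linear_def rad_def)
    show "rad_linear a (Suc h) (insert h x) = rad_linear a h x - a h" for x
      using rad_linear_insert[of h h a x] by (simp add: rad_linear_def rad_def)
  qed (use assms in \<open>auto simp: sum_nonneg card_Pow power_mult\<close>)
  then show ?case by (simp add: distrib_left)
qed

text \<open>The new sign multiplies a linear form: the moments of that form cost one factor 2r-1 and
  the sign costs another.\<close>

lemma rad_quadratic_moment_le:
  assumes "r \<ge> 1"
  shows "(\<Sum>x\<in>Pow {..<h}. rad_quadratic a h x ^ (2 * r))
      \<le> 2 ^ h * ((2 * real r - 1)\<^sup>2 * (\<Sum>j<h. \<Sum>i<j. (a j i)\<^sup>2)) ^ r"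
proof (induction h)
  case 0
  then show ?case using assms by (simp add: rad_quadratic_def power_0_left)
next
  case (Suc h)
  have "(\<Sum>x\<in>Pow {..<Suc h}. rad_quadratic a (Suc h) x ^ (2 * r))
      \<le> 2 ^ Suc h * ((2 * real r - 1)\<^sup>2 * (\<Sum>j<h. \<Sum>i<j. (a j i)\<^sup>2)
          + (2 * real r - 1) * ((2 * real r - 1) * (\<Sum>i<h. (a h i)\<^sup>2))) ^ r"
  proof (rule moment_step[OF _ Suc _ rad_linear_moment_le[OF assms, where h = h and a = "a h"]])
    show "rad_quadratic a (Suc h) x = rad_quadratic a h x + rad_linear (a h) h x" if "x \<subseteq> {..<h}" for x
      using that by (auto simp: rad_quadratic_def rad_def)
    show "rad_quadratic a (Suc h) (insert h x) = rad_quadratic a h x - rad_linear (a h) h x" for x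
      using rad_quadratic_insert[of a h x] rad_linear_insert[of h h "a h" x]
      by (simp add: rad_quadratic_def rad_def)
  qed (use assms in \<open>auto intro!: sum_nonneg mult_nonneg_nonneg\<close>)
  then show ?case by (simp add: distrib_left power2_eq_square mult.assoc)
qed

text \<open>By duality: the quadratic form whose coefficients are the degree-two Fourier
  coefficients of the probability \<open>f / p\<close> has mean \<open>B\<close> under it. Since
  \<open>f / p\<close> has density at most 2^r relative to uniform, its 2r-th moment is at most 2^r
  times the uniform one, which is bounded in terms of \<open>B\<close> again.\<close>

lemma level_two_inequality:
  fixes f :: "nat set \<Rightarrow> real"
  assumes f: "\<And>x. x \<subseteq> {..<h} \<Longrightarrow> 0 \<le> f x" "\<And>x. x \<subseteq> {..<h} \<Longrightarrow> f x \<le> 1 / 2 ^ h"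
    and r: "r \<ge> 1" and p: "p = (\<Sum>x\<in>Pow {..<h}. f x)" "p \<ge> 1 / 2 ^ r"
  shows "(\<Sum>j<h. \<Sum>i<j. (\<Sum>x\<in>Pow {..<h}. f x * rad x i * rad x j)\<^sup>2) \<le> 8 * (real r)\<^sup>2 * p\<^sup>2"
proof -
  let ?X = "Pow {..<h}"
  have "p > 0" using p(2) by (rule less_le_trans[rotated]) simp
  define a where "a = (\<lambda>j i. (\<Sum>x\<in>?X. f x * rad x i * rad x j) / p)"
  define q where "q = rad_quadratic a h"
  define B where "B = (\<Sum>j<h. \<Sum>i<j. (a j i)\<^sup>2)"
  have "B \<ge> 0" by (auto simp: B_def intro!: sum_nonneg)
  have "(\<Sum>x\<in>?X. f x / p * q x) = (\<Sum>j<h. \<Sum>i<j. \<Sum>x\<in>?X. a j i * (f x * rad x i * rad x j / p))"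
    unfolding q_def rad_quadratic_def rad_linear_def sum_distrib_left
    by (subst sum.swap, intro sum.cong refl, subst sum.swap, intro sum.cong refl) (simp add: mult_ac)
  also have "\<dots> = B"
    unfolding B_def a_def by (simp add: sum_distrib_left[symmetric] sum_divide_distrib[symmetric] power2_eq_square)
  finally have Eq: "(\<Sum>x\<in>?X. f x / p * q x) = B" .
  have conv: "convex_on UNIV (\<lambda>t::real. t ^ (2 * r))"
    by (rule convex_power_even) simp
  \<comment> \<open>Jensen with the weights \<open>f x / p\<close>, which sum to one.\<close>
  have "B ^ (2 * r) \<le> (\<Sum>x\<in>?X. f x / p * q x ^ (2 * r))"
    unfolding Eq[symmetric]
    using convex_on_sum[OF _ _ conv, of ?X "\<lambda>x. f x / p" q] f(1) Pow_not_empty[of "{..<h}"] \<open>p > 0\<close>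
    by (simp add: sum_divide_distrib[symmetric] p(1)[symmetric])
  also have "\<dots> \<le> (\<Sum>x\<in>?X. (1 / 2 ^ h) / p * q x ^ (2 * r))"
    using f(2) \<open>p > 0\<close> by (intro sum_mono mult_right_mono divide_right_mono) auto
  also have "\<dots> = (\<Sum>x\<in>?X. q x ^ (2 * r)) / (2 ^ h * p)"
    by (simp add: sum_divide_distrib)
  also have "\<dots> \<le> (2 ^ h * ((2 * real r - 1)\<^sup>2 * B) ^ r) / (2 ^ h * p)"
    unfolding q_def B_def using \<open>p > 0\<close> by (intro divide_right_mono rad_quadratic_moment_le r) auto
  also have "\<dots> = ((2 * real r - 1)\<^sup>2 * B) ^ r / p" by simp
  also have "\<dots> \<le> ((2 * real r - 1)\<^sup>2 * B) ^ r * 2 ^ r"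
    using p(2) \<open>p > 0\<close> \<open>B \<ge> 0\<close>
    by (subst divide_inverse, intro mult_left_mono) (auto simp: field_simps)
  also have "\<dots> = (2 * (2 * real r - 1)\<^sup>2 * B) ^ r" by (simp add: power_mult_distrib)
  finally have "(B\<^sup>2) ^ r \<le> (2 * (2 * real r - 1)\<^sup>2 * B) ^ r" by (simp add: power_mult)
  \<comment> \<open>As the moment order 2r is tied to the density bound 2^r, the r-th root turns the
    density factor into the constant 2. Cancelling one \<open>B\<close> then leaves an absolute
    bound.\<close>
  then have "B\<^sup>2 \<le> 2 * (2 * real r - 1)\<^sup>2 * B"
    using r \<open>B \<ge> 0\<close> by (subst (asm) power_mono_iff) auto
  then have "B \<le> 2 * (2 * real r - 1)\<^sup>2"
    using \<open>B \<ge> 0\<close> by (cases "B = 0") (auto simp: power2_eq_square)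
  also have "\<dots> \<le> 2 * (2 * real r)\<^sup>2" using r by (intro mult_left_mono power_mono) auto
  finally have "B * p\<^sup>2 \<le> 8 * (real r)\<^sup>2 * p\<^sup>2" by (intro mult_right_mono) auto
  moreover have "B * p\<^sup>2 = (\<Sum>j<h. \<Sum>i<j. (\<Sum>x\<in>?X. f x * rad x i * rad x j)\<^sup>2)"
    using \<open>p > 0\<close> by (simp add: B_def a_def power_divide sum_distrib_right)
  ultimately show ?thesis by simp
qed

section \<open>Hellinger affinity of memory distributions\<close>

lemma sum_sqrt_mult_le:
  fixes a b :: "'a \<Rightarrow> real"
  assumes "\<And>i. i \<in> I \<Longrightarrow> a i \<ge> 0" "\<And>i. i \<in> I \<Longrightarrow> b i \<ge> 0"
  shows "(\<Sum>i\<in>I. sqrt (a i * b i)) \<le> sqrt ((\<Sum>i\<in>I. a i) * (\<Sum>i\<in>I. b i))"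
proof (rule real_le_rsqrt)
  have "(\<Sum>i\<in>I. sqrt (a i * b i))\<^sup>2 \<le> (\<Sum>i\<in>I. (sqrt (a i))\<^sup>2) * (\<Sum>i\<in>I. (sqrt (b i))\<^sup>2)"
    unfolding real_sqrt_mult by (rule Cauchy_Schwarz_ineq_sum)
  also have "\<dots> = (\<Sum>i\<in>I. a i) * (\<Sum>i\<in>I. b i)"
    using assms by simp
  finally show "(\<Sum>i\<in>I. sqrt (a i * b i))\<^sup>2 \<le> (\<Sum>i\<in>I. a i) * (\<Sum>i\<in>I. b i)" .
qed

text \<open>With y = sqrt (1 + b), twice the difference of the two sides factors as y (y - 1)^2 (y +
  2).\<close>

lemma sqrt_one_plus_ge:
  fixes b :: real
  assumes "b \<ge> -1"
  shows "sqrt (1 + b) \<ge> 1 + b / 2 - b\<^sup>2 / 2"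
proof -
  define y where "y = sqrt (1 + b)"
  have y: "y \<ge> 0" "b = y\<^sup>2 - 1" using assms by (auto simp: y_def)
  have "0 \<le> (y - 1)\<^sup>2 * (y + 2) * y" using y by simp
  also have "\<dots> = 2 * (y - (1 + b / 2 - b\<^sup>2 / 2))"
    unfolding y(2) by (simp add: power2_eq_square field_simps)
  finally show ?thesis by (simp add: y_def)
qed

text \<open>Factor out \<open>sqrt (p * q)\<close> and take b = g / p in the previous bound. For
  \<open>p = 0\<close> also \<open>g = 0\<close>, and both sides vanish.\<close>

lemma sqrt_mult_add_ge:
  fixes p q g :: real
  assumes "q \<ge> 0" "\<bar>g\<bar> \<le> p"
  shows "sqrt (q * (p + g)) \<ge> sqrt (p * q) * (1 + (g / p) / 2 - (g / p)\<^sup>2 / 2)"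
proof (cases "p = 0")
  case False
  then have "p > 0" using assms by simp
  then have "g / p \<ge> -1" using assms by (simp add: field_simps)
  moreover have "q * (p + g) = p * q * (1 + g / p)" using \<open>p > 0\<close> by (simp add: field_simps)
  ultimately show ?thesis using assms \<open>p > 0\<close>
    by (simp only: real_sqrt_mult) (intro mult_left_mono sqrt_one_plus_ge, auto)
qed (use assms in simp)

section \<open>Sums over words of fixed length\<close>

definition words :: "'e set \<Rightarrow> nat \<Rightarrow> 'e list set" where
  "words S t = {es. set es \<subseteq> S \<and> length es = t}"

lemma finite_words [simp]: "finite S \<Longrightarrow> finite (words S t)"
  unfolding words_def by (rule finite_lists_length_eq)

lemma words_0 [simp]: "words S 0 = {[]}"
  by (auto simp: words_def)

lemma sum_words_Suc:
  fixes F :: "'e list \<Rightarrow> 'a::comm_monoid_add"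
  shows "(\<Sum>es\<in>words S (Suc t). F es) = (\<Sum>es\<in>words S t. \<Sum>e\<in>S. F (es @ [e]))"
proof -
  have "words S (Suc t) = (\<lambda>(es, e). es @ [e]) ` (words S t \<times> S)"
  proof (intro equalityI subsetI)
    fix es assume es: "es \<in> words S (Suc t)"
    then have "es = butlast es @ [last es]" "set (butlast es) \<subseteq> S" "last es \<in> S"
      by (auto simp: words_def dest: in_set_butlastD simp flip: length_greater_0_conv)
    then show "es \<in> (\<lambda>(es, e). es @ [e]) ` (words S t \<times> S)"
      using es by (auto simp: words_def intro!: image_eqI[where x = "(butlast es, last es)"])
  qed (auto simp: words_def)
  moreover have "inj_on (\<lambda>(es, e). es @ [e]) (words S t \<times> S)" by (auto simp: inj_on_def)
  ultimately have "(\<Sum>es\<in>words S (Suc t). F es) = (\<Sum>(es, e)\<in>words S t \<times> S. F (es @ [e]))"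
    by (simp add: sum.reindex case_prod_unfold)
  then show ?thesis by (simp add: sum.cartesian_product)
qed

lemma sum_words_prod_list:
  fixes w :: "'e \<Rightarrow> 'a::comm_semiring_1"
  shows "(\<Sum>es\<in>words S t. prod_list (map w es)) = (\<Sum>e\<in>S. w e) ^ t"
  by (induction t) (simp_all add: sum_words_Suc sum_distrib_left[symmetric] sum_distrib_right[symmetric] mult.commute)

text \<open>A hidden \<open>x \<in> X\<close> is drawn uniformly; the letters of the stream are then independent with density
  \<open>1 + \<phi> x\<close> relative to the uniform distribution on \<open>S\<close>. The memory is to be distinguished from the
  one reached on uniform letters.\<close>

locale hidden_stream =
  fixes S :: "'e set" and X :: "'x set" and \<phi> :: "'x \<Rightarrow> 'e \<Rightarrow> real"
    and mem :: "'e list \<Rightarrow> 'w" and upd :: "nat \<Rightarrow> 'w \<Rightarrow> 'e \<Rightarrow> 'w"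
  assumes finite_S: "finite S" and S_ne: "S \<noteq> {}" and finite_X: "finite X" and X_ne: "X \<noteq> {}"
    and \<phi>_abs: "\<And>x e. x \<in> X \<Longrightarrow> e \<in> S \<Longrightarrow> \<bar>\<phi> x e\<bar> \<le> 1"
    and \<phi>_sum: "\<And>x. x \<in> X \<Longrightarrow> (\<Sum>e\<in>S. \<phi> x e) = 0"
    and mem_snoc: "\<And>es e. mem (es @ [e]) = upd (length es) (mem es) e"
begin

definition states :: "nat \<Rightarrow> 'w set" where
  "states t = mem ` words S t"

text \<open>For letter weights that sum to one this is the distribution of the memory after
  \<open>t\<close> independent letters. General weights let the planted and the uniform stream share
  one definition.\<close>

definition law :: "('e \<Rightarrow> real) \<Rightarrow> nat \<Rightarrow> 'w \<Rightarrow> real" where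
  "law w t \<sigma> = (\<Sum>es\<in>words S t. of_bool (mem es = \<sigma>) * prod_list (map w es))"

definition yes_weight :: "'x \<Rightarrow> 'e \<Rightarrow> real" where
  "yes_weight x e = (1 + \<phi> x e) / card S"

definition yes_law :: "nat \<Rightarrow> 'w \<Rightarrow> real" where
  "yes_law t \<sigma> = (\<Sum>x\<in>X. law (yes_weight x) t \<sigma> / card X)"

definition no_law :: "nat \<Rightarrow> 'w \<Rightarrow> real" where
  "no_law = law (\<lambda>_. 1 / card S)"

text \<open>The posterior mean of \<open>\<phi>\<close> given memory \<open>\<sigma>\<close>,
  multiplied by the probability of \<open>\<sigma>\<close>; leaving it unnormalised avoids dividing
  by zero.\<close>

definition bias :: "nat \<Rightarrow> 'w \<Rightarrow> 'e \<Rightarrow> real" where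
  "bias t \<sigma> e = (\<Sum>x\<in>X. law (yes_weight x) t \<sigma> / card X * \<phi> x e)"

definition affinity :: "nat \<Rightarrow> real" where
  "affinity t = (\<Sum>\<sigma>\<in>states t. sqrt (yes_law t \<sigma> * no_law t \<sigma>))"

lemma card_S: "real (card S) > 0" and card_X: "real (card X) > 0"
  using finite_S S_ne finite_X X_ne by (auto simp: card_gt_0_iff)

lemma finite_states [simp]: "finite (states t)"
  by (simp add: states_def finite_S)

lemma upd_states: "\<sigma> \<in> states t \<Longrightarrow> e \<in> S \<Longrightarrow> upd t \<sigma> e \<in> states (Suc t)"
  by (auto simp: states_def words_def mem_snoc[symmetric] intro!: imageI)

lemma sum_states_law:
  "(\<Sum>\<sigma>\<in>states t. G \<sigma> * law w t \<sigma>) = (\<Sum>es\<in>words S t. G (mem es) * prod_list (map w es))"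
proof -
  have "(\<Sum>\<sigma>\<in>states t. G \<sigma> * law w t \<sigma>)
      = (\<Sum>es\<in>words S t. \<Sum>\<sigma>\<in>states t. (if \<sigma> = mem es then G \<sigma> * prod_list (map w es) else 0))"
    unfolding law_def sum_distrib_left by (subst sum.swap) (auto intro!: sum.cong)
  also have "\<dots> = (\<Sum>es\<in>words S t. G (mem es) * prod_list (map w es))"
    by (intro sum.cong refl) (simp add: sum.delta states_def finite_S)
  finally show ?thesis .
qed

text \<open>Product weights make the newest letter independent of the current memory, and the update
  sees only these two, so the law evolves like that of a Markov chain.\<close>

lemma law_Suc:
  "law w (Suc t) \<tau> = (\<Sum>\<sigma>\<in>states t. \<Sum>e\<in>S. of_bool (upd t \<sigma> e = \<tau>) * (law w t \<sigma> * w e))"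
proof -
  have "(\<Sum>\<sigma>\<in>states t. \<Sum>e\<in>S. of_bool (upd t \<sigma> e = \<tau>) * (law w t \<sigma> * w e))
      = (\<Sum>\<sigma>\<in>states t. (\<Sum>e\<in>S. of_bool (upd t \<sigma> e = \<tau>) * w e) * law w t \<sigma>)"
    unfolding sum_distrib_right by (intro sum.cong refl) (simp add: mult_ac)
  also have "\<dots> = (\<Sum>es\<in>words S t. (\<Sum>e\<in>S. of_bool (upd t (mem es) e = \<tau>) * w e) * prod_list (map w es))"
    by (rule sum_states_law)
  also have "\<dots> = law w (Suc t) \<tau>"
    unfolding law_def sum_words_Suc
    by (intro sum.cong refl, subst sum_distrib_right, intro sum.cong refl)
       (simp add: mem_snoc words_def mult_ac)
  finally show ?thesis ..
qed

lemma law_nonneg: "(\<And>e. e \<in> S \<Longrightarrow> w e \<ge> 0) \<Longrightarrow> law w t \<sigma> \<ge> 0"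
  unfolding law_def by (intro sum_nonneg mult_nonneg_nonneg prod_list_nonneg) (auto simp: words_def)

lemma sum_law: "(\<Sum>\<sigma>\<in>states t. law w t \<sigma>) = (\<Sum>e\<in>S. w e) ^ t"
  using sum_states_law[where G = "\<lambda>_. 1"] by (simp add: sum_words_prod_list)

lemma yes_weight_nonneg: "x \<in> X \<Longrightarrow> e \<in> S \<Longrightarrow> yes_weight x e \<ge> 0"
  using \<phi>_abs[of x e] by (simp add: yes_weight_def)

lemma sum_yes_weight: "x \<in> X \<Longrightarrow> (\<Sum>e\<in>S. yes_weight x e) = 1"
  using card_S by (simp add: yes_weight_def sum_divide_distrib[symmetric] sum.distrib \<phi>_sum)

lemma yes_component_nonneg: "x \<in> X \<Longrightarrow> law (yes_weight x) t \<sigma> \<ge> 0"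
  by (intro law_nonneg yes_weight_nonneg)

lemma yes_component_le:
  assumes "x \<in> X" "\<sigma> \<in> states t"
  shows "law (yes_weight x) t \<sigma> \<le> 1"
proof -
  have "law (yes_weight x) t \<sigma> \<le> (\<Sum>\<sigma>\<in>states t. law (yes_weight x) t \<sigma>)"
    using assms by (intro member_le_sum yes_component_nonneg) auto
  then show ?thesis using assms by (simp add: sum_law sum_yes_weight)
qed

lemma yes_law_nonneg: "yes_law t \<sigma> \<ge> 0"
  unfolding yes_law_def by (intro sum_nonneg divide_nonneg_nonneg yes_component_nonneg) auto

lemma no_law_nonneg: "no_law t \<sigma> \<ge> 0"
  unfolding no_law_def by (intro law_nonneg) auto

lemma sum_no_law: "(\<Sum>\<sigma>\<in>states t. no_law t \<sigma>) = 1"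
  using card_S by (simp add: no_law_def sum_law)

lemma sum_yes_law: "(\<Sum>\<sigma>\<in>states t. yes_law t \<sigma>) = 1"
  unfolding yes_law_def using card_X
  by (subst sum.swap) (simp add: sum_divide_distrib[symmetric] sum_law sum_yes_weight)

lemma abs_bias_le: "e \<in> S \<Longrightarrow> \<bar>bias t \<sigma> e\<bar> \<le> yes_law t \<sigma>"
  unfolding bias_def yes_law_def
  by (intro order_trans[OF sum_abs] sum_mono)
     (use yes_component_nonneg \<phi>_abs in \<open>auto simp: abs_mult intro!: mult_left_le divide_right_mono\<close>)

lemma sum_bias: "(\<Sum>e\<in>S. bias t \<sigma> e) = 0"
  unfolding bias_def by (subst sum.swap) (simp add: sum_distrib_left[symmetric] \<phi>_sum del: times_divide_eq_left)

section \<open>Loss of affinity in one step\<close>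

lemma yes_law_Suc:
  "yes_law (Suc t) \<tau>
    = (\<Sum>\<sigma>\<in>states t. \<Sum>e\<in>S. of_bool (upd t \<sigma> e = \<tau>) * (yes_law t \<sigma> + bias t \<sigma> e)) / card S"
proof -
  have "yes_law (Suc t) \<tau> = (\<Sum>\<sigma>\<in>states t. \<Sum>e\<in>S. \<Sum>x\<in>X.
      of_bool (upd t \<sigma> e = \<tau>) * (law (yes_weight x) t \<sigma> * yes_weight x e) / card X)"
    unfolding yes_law_def law_Suc sum_divide_distrib
    by (subst sum.swap, intro sum.cong refl, rule sum.swap)
  \<comment> \<open>Averaging the factor \<open>1 + \<phi> x e\<close> over \<open>x\<close>: the
    constant part yields \<open>yes_law\<close> and the rest is \<open>bias\<close>.\<close>
  also have "\<dots> = (\<Sum>\<sigma>\<in>states t. \<Sum>e\<in>S. of_bool (upd t \<sigma> e = \<tau>) * (yes_law t \<sigma> + bias t \<sigma> e) / card S)"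
    unfolding yes_law_def bias_def sum.distrib[symmetric] sum_distrib_left sum_divide_distrib
    by (intro sum.cong refl) (simp add: yes_weight_def algebra_simps add_divide_distrib)
  finally show ?thesis by (simp add: sum_divide_distrib)
qed

lemma no_law_Suc:
  "no_law (Suc t) \<tau> = (\<Sum>\<sigma>\<in>states t. \<Sum>e\<in>S. of_bool (upd t \<sigma> e = \<tau>) * no_law t \<sigma>) / card S"
  unfolding no_law_def law_Suc by (simp add: sum_divide_distrib)

text \<open>Data processing: the new memory is a function of the pair (old memory, letter), and
  merging pairs cannot lower the affinity, by Cauchy-Schwarz on each fibre of the update.\<close>

lemma affinity_Suc_ge_sum:
  "affinity (Suc t) \<ge> (\<Sum>\<sigma>\<in>states t. \<Sum>e\<in>S. sqrt (no_law t \<sigma> * (yes_law t \<sigma> + bias t \<sigma> e))) / card S"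
proof -
  let ?s = "\<lambda>\<sigma> e. sqrt (no_law t \<sigma> * (yes_law t \<sigma> + bias t \<sigma> e))"
  have nn: "yes_law t \<sigma> + bias t \<sigma> e \<ge> 0" if "e \<in> S" for \<sigma> e
    using abs_bias_le[OF that, of t \<sigma>] by linarith
  have sw: "(\<Sum>\<tau>\<in>states (Suc t). \<Sum>\<sigma>\<in>states t. \<Sum>e\<in>S. of_bool (upd t \<sigma> e = \<tau>) * ?s \<sigma> e)
     = (\<Sum>\<sigma>\<in>states t. \<Sum>e\<in>S. ?s \<sigma> e)"
  proof -
    have "(\<Sum>\<tau>\<in>states (Suc t). \<Sum>\<sigma>\<in>states t. \<Sum>e\<in>S. of_bool (upd t \<sigma> e = \<tau>) * ?s \<sigma> e)
        = (\<Sum>\<sigma>\<in>states t. \<Sum>e\<in>S. \<Sum>\<tau>\<in>states (Suc t). (if upd t \<sigma> e = \<tau> then ?s \<sigma> e else 0))"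
      by (subst sum.swap, intro sum.cong refl, subst sum.swap) (auto intro!: sum.cong)
    also have "\<dots> = (\<Sum>\<sigma>\<in>states t. \<Sum>e\<in>S. ?s \<sigma> e)"
      by (intro sum.cong refl) (simp add: sum.delta' upd_states)
    finally show ?thesis .
  qed
  have "(\<Sum>\<sigma>\<in>states t. \<Sum>e\<in>S. of_bool (upd t \<sigma> e = \<tau>) * ?s \<sigma> e) / card S
      \<le> sqrt (yes_law (Suc t) \<tau> * no_law (Suc t) \<tau>)" for \<tau>
  proof -
    let ?a = "\<lambda>(\<sigma>, e). of_bool (upd t \<sigma> e = \<tau>) * (yes_law t \<sigma> + bias t \<sigma> e)"
    let ?b = "\<lambda>(\<sigma>, e). of_bool (upd t \<sigma> e = \<tau>) * no_law t \<sigma>"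
    have "(\<Sum>\<sigma>\<in>states t. \<Sum>e\<in>S. of_bool (upd t \<sigma> e = \<tau>) * ?s \<sigma> e)
        = (\<Sum>i\<in>states t \<times> S. sqrt (?a i * ?b i))"
      unfolding sum.cartesian_product by (intro sum.cong refl) (auto simp: mult.commute)
    also have "\<dots> \<le> sqrt ((\<Sum>i\<in>states t \<times> S. ?a i) * (\<Sum>i\<in>states t \<times> S. ?b i))"
      by (rule sum_sqrt_mult_le) (use nn no_law_nonneg in auto)
    also have "\<dots> = sqrt (yes_law (Suc t) \<tau> * no_law (Suc t) \<tau> * (card S)\<^sup>2)"
      unfolding yes_law_Suc no_law_Suc using card_S
      by (simp add: sum.cartesian_product power2_eq_square)
    also have "\<dots> = sqrt (yes_law (Suc t) \<tau> * no_law (Suc t) \<tau>) * card S"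
      by (simp add: real_sqrt_mult)
    finally show ?thesis using card_S by (simp add: field_simps)
  qed
  then have "(\<Sum>\<tau>\<in>states (Suc t). (\<Sum>\<sigma>\<in>states t. \<Sum>e\<in>S. of_bool (upd t \<sigma> e = \<tau>) * ?s \<sigma> e) / card S) \<le> affinity (Suc t)"
    unfolding affinity_def by (intro sum_mono)
  then show ?thesis by (simp only: sum_divide_distrib[symmetric] sw)
qed

lemma affinity_le_1: "affinity t \<le> 1"
  unfolding affinity_def
  using sum_sqrt_mult_le[of "states t" "yes_law t" "no_law t"] yes_law_nonneg no_law_nonneg
  by (simp add: sum_yes_law sum_no_law)

text \<open>Expand the square root to second order. States of probability at least
  \<open>\<theta>\<close> lose at most a fraction \<open>w / 2\<close> of their affinity; lighter
  states may lose half of theirs, but all of them together carry at most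
  \<open>sqrt (\<theta> * M)\<close>.\<close>

lemma affinity_Suc_ge:
  fixes w \<theta> M :: real
  assumes states: "real (card (states t)) \<le> M" and w: "w \<ge> 0" and \<theta>: "\<theta> \<ge> 0"
    and level: "\<And>\<sigma>. \<sigma> \<in> states t \<Longrightarrow> yes_law t \<sigma> \<ge> \<theta> \<Longrightarrow>
                  (\<Sum>e\<in>S. (bias t \<sigma> e)\<^sup>2) \<le> card S * w * (yes_law t \<sigma>)\<^sup>2"
  shows "affinity (Suc t) \<ge> affinity t - (w + sqrt (\<theta> * M)) / 2"
proof -
  define z where "z \<sigma> = sqrt (yes_law t \<sigma> * no_law t \<sigma>)" for \<sigma>
  have z: "z \<sigma> \<ge> 0" for \<sigma> by (simp add: z_def yes_law_nonneg no_law_nonneg)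
  have loss: "(\<Sum>e\<in>S. sqrt (no_law t \<sigma> * (yes_law t \<sigma> + bias t \<sigma> e))) / card S
      \<ge> z \<sigma> - (z \<sigma> * w + sqrt \<theta> * sqrt (no_law t \<sigma>)) / 2" if "\<sigma> \<in> states t" for \<sigma>
  proof -
    define B where "B = (\<Sum>e\<in>S. (bias t \<sigma> e / yes_law t \<sigma>)\<^sup>2) / card S"
    \<comment> \<open>The linear terms cancel because the bias sums to zero over \<open>S\<close>;
      only the quadratic loss remains.\<close>
    have "z \<sigma> * (card S - (\<Sum>e\<in>S. (bias t \<sigma> e / yes_law t \<sigma>)\<^sup>2) / 2)
        = (\<Sum>e\<in>S. z \<sigma> * (1 + (bias t \<sigma> e / yes_law t \<sigma>) / 2 - (bias t \<sigma> e / yes_law t \<sigma>)\<^sup>2 / 2))"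
      unfolding sum_distrib_left[symmetric] sum_subtractf sum.distrib sum_divide_distrib[symmetric]
      by (simp add: sum_bias)
    also have "\<dots> \<le> (\<Sum>e\<in>S. sqrt (no_law t \<sigma> * (yes_law t \<sigma> + bias t \<sigma> e)))"
      unfolding z_def by (intro sum_mono sqrt_mult_add_ge no_law_nonneg abs_bias_le)
    finally have "z \<sigma> * (card S - (\<Sum>e\<in>S. (bias t \<sigma> e / yes_law t \<sigma>)\<^sup>2) / 2) / card S
        \<le> (\<Sum>e\<in>S. sqrt (no_law t \<sigma> * (yes_law t \<sigma> + bias t \<sigma> e))) / card S"
      by (intro divide_right_mono) auto
    then have 1: "z \<sigma> * (1 - B / 2) \<le> (\<Sum>e\<in>S. sqrt (no_law t \<sigma> * (yes_law t \<sigma> + bias t \<sigma> e))) / card S"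
      unfolding B_def using card_S by (simp add: right_diff_distrib diff_divide_distrib)
    have "z \<sigma> * B \<le> z \<sigma> * w + sqrt \<theta> * sqrt (no_law t \<sigma>)"
    proof (cases "yes_law t \<sigma> \<ge> \<theta>")
      case True
      \<comment> \<open>If \<open>yes_law t \<sigma>\<close> is zero, then \<open>z \<sigma>\<close>
        vanishes and the estimate is trivial.\<close>
      have "B \<le> w \<or> yes_law t \<sigma> = 0"
        using level[OF that True] card_S yes_law_nonneg[of t \<sigma>]
        by (auto simp: B_def power_divide sum_divide_distrib[symmetric] field_simps)
      then have "z \<sigma> * B \<le> z \<sigma> * w" using z by (auto intro: mult_left_mono simp: z_def)
      then show ?thesis using \<theta> no_law_nonneg[of t \<sigma>] by (simp add: add_increasing2)
    next
      case False
      \<comment> \<open>For a light state the bias is controlled only by the trivial relative bound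
        1; the gain comes from \<open>z \<sigma>\<close>, which contains the factor sqrt (yes_law)
        below \<open>sqrt \<theta>\<close>.\<close>
      have "(bias t \<sigma> e / yes_law t \<sigma>)\<^sup>2 \<le> 1" if "e \<in> S" for e
        using abs_bias_le[OF that, of t \<sigma>] yes_law_nonneg[of t \<sigma>]
        by (cases "yes_law t \<sigma> = 0") (auto simp: abs_square_le_1)
      then have "(\<Sum>e\<in>S. (bias t \<sigma> e / yes_law t \<sigma>)\<^sup>2) \<le> (\<Sum>e\<in>S. 1)" by (intro sum_mono)
      then have "B \<le> 1" using card_S by (simp add: B_def)
      then have "z \<sigma> * B \<le> z \<sigma>" using z by (simp add: mult_left_le)
      also have "\<dots> \<le> sqrt \<theta> * sqrt (no_law t \<sigma>)"
        using False no_law_nonneg[of t \<sigma>] by (auto simp: z_def real_sqrt_mult intro!: mult_right_mono)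
      finally show ?thesis using w z[of \<sigma>] by (simp add: add_increasing)
    qed
    then show ?thesis using 1 by (simp add: right_diff_distrib add_divide_distrib)
  qed
  \<comment> \<open>Cauchy-Schwarz against the constant 1; this is where the number of memory states
    enters.\<close>
  have "(\<Sum>\<sigma>\<in>states t. sqrt (no_law t \<sigma>)) \<le> sqrt (1 * card (states t))"
    using sum_sqrt_mult_le[of "states t" "no_law t" "\<lambda>_. 1"] no_law_nonneg by (simp add: sum_no_law)
  also have "\<dots> \<le> sqrt M" using states by simp
  finally have A: "sqrt \<theta> * (\<Sum>\<sigma>\<in>states t. sqrt (no_law t \<sigma>)) \<le> sqrt (\<theta> * M)"
    using \<theta> by (simp add: real_sqrt_mult mult_left_mono)
  have "affinity t * w \<le> 1 * w" using w affinity_le_1 by (intro mult_right_mono)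
  then have "affinity t - (w + sqrt (\<theta> * M)) / 2
      \<le> affinity t - (affinity t * w + sqrt \<theta> * (\<Sum>\<sigma>\<in>states t. sqrt (no_law t \<sigma>))) / 2"
    using A by (intro diff_left_mono divide_right_mono add_mono) auto
  also have "\<dots> = (\<Sum>\<sigma>\<in>states t. z \<sigma> - (z \<sigma> * w + sqrt \<theta> * sqrt (no_law t \<sigma>)) / 2)"
    unfolding affinity_def z_def sum_subtractf sum_divide_distrib[symmetric] sum.distrib
      sum_distrib_left sum_distrib_right ..
  also have "\<dots> \<le> affinity (Suc t)"
    by (rule order_trans[OF sum_mono[OF loss]])
       (use affinity_Suc_ge_sum[of t] in \<open>simp_all add: sum_divide_distrib[symmetric]\<close>)
  finally show ?thesis .
qed

lemma affinity_ge:
  fixes w \<theta> M :: real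
  assumes states: "\<And>t. t < m \<Longrightarrow> real (card (states t)) \<le> M" and w: "w \<ge> 0" and \<theta>: "\<theta> \<ge> 0"
    and level: "\<And>t \<sigma>. t < m \<Longrightarrow> \<sigma> \<in> states t \<Longrightarrow> yes_law t \<sigma> \<ge> \<theta> \<Longrightarrow>
                  (\<Sum>e\<in>S. (bias t \<sigma> e)\<^sup>2) \<le> card S * w * (yes_law t \<sigma>)\<^sup>2"
  shows "affinity m \<ge> 1 - m * ((w + sqrt (\<theta> * M)) / 2)"
proof -
  have "affinity t \<ge> 1 - t * ((w + sqrt (\<theta> * M)) / 2)" if "t \<le> m" for t
    using that
  proof (induction t)
    case 0
    \<comment> \<open>Before the first letter both laws are the point mass at the initial memory, so
      the affinity is 1.\<close>
    have "states 0 = {mem []}" by (simp add: states_def)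
    then show ?case using card_X by (simp add: affinity_def yes_law_def no_law_def law_def)
  next
    case (Suc t)
    have "affinity (Suc t) \<ge> affinity t - (w + sqrt (\<theta> * M)) / 2"
      by (rule affinity_Suc_ge) (use Suc.prems states w \<theta> level in auto)
    then show ?case using Suc by (simp add: algebra_simps add_divide_distrib)
  qed
  then show ?thesis by blast
qed

text \<open>A pointwise bound on p - q by p + q and sqrt (p q), summed over the states. It is linear
  in the affinity, in contrast to the usual bound by a square root.\<close>

lemma accept_diff_le:
  "(\<Sum>x\<in>X. \<Sum>es\<in>words S m. of_bool (acc (mem es)) * prod_list (map (yes_weight x) es)) / card X
    - (\<Sum>es\<in>words S m. of_bool (acc (mem es))) / card S ^ m \<le> 8 * (1 - affinity m) + 1 / 4"
proof -
  have yes: "(\<Sum>x\<in>X. \<Sum>es\<in>words S m. of_bool (acc (mem es)) * prod_list (map (yes_weight x) es)) / card X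
      = (\<Sum>\<sigma>\<in>states m. of_bool (acc \<sigma>) * yes_law m \<sigma>)"
    unfolding sum_states_law[where G = "\<lambda>\<sigma>. of_bool (acc \<sigma>)", symmetric]
      yes_law_def sum_distrib_left sum_divide_distrib
    by (subst (2) sum.swap) simp
  have no: "(\<Sum>es\<in>words S m. of_bool (acc (mem es))) / card S ^ m
      = (\<Sum>\<sigma>\<in>states m. of_bool (acc \<sigma>) * no_law m \<sigma>)"
    unfolding no_law_def sum_states_law sum_divide_distrib
    by (intro sum.cong refl) (auto simp: words_def map_replicate_const prod_list_replicate power_divide)
  have pt: "of_bool b * (p - q) \<le> (33/8) * (p + q) - 8 * sqrt (p * q)"
    if "p \<ge> 0" "q \<ge> 0" for b and p q :: real
  proof -
    define y z where "y = sqrt p" and "z = sqrt q"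
    have yz: "p = y\<^sup>2" "q = z\<^sup>2" "sqrt (p * q) = y * z"
      using that by (auto simp: y_def z_def real_sqrt_mult)
    \<comment> \<open>Completing the square: 200 times the slack in the next inequality is exactly
      this expression.\<close>
    have "0 \<le> (25 * y - 32 * z)\<^sup>2 + z\<^sup>2" by simp
    then have "p - q \<le> (33/8) * (p + q) - 8 * sqrt (p * q)"
      unfolding yz(3) unfolding yz(1,2) by (simp add: power2_eq_square algebra_simps)
    moreover have "0 \<le> 32 * (y - z)\<^sup>2 + y\<^sup>2 + z\<^sup>2" by simp
    then have "0 \<le> (33/8) * (p + q) - 8 * sqrt (p * q)"
      unfolding yz(3) unfolding yz(1,2) by (simp add: power2_eq_square algebra_simps)
    ultimately show ?thesis by (cases b) auto
  qed
  have "(\<Sum>\<sigma>\<in>states m. of_bool (acc \<sigma>) * (yes_law m \<sigma> - no_law m \<sigma>))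
      \<le> (\<Sum>\<sigma>\<in>states m. (33/8) * (yes_law m \<sigma> + no_law m \<sigma>) - 8 * sqrt (yes_law m \<sigma> * no_law m \<sigma>))"
    by (intro sum_mono pt yes_law_nonneg no_law_nonneg)
  also have "\<dots> = 8 * (1 - affinity m) + 1 / 4"
    unfolding sum_subtractf sum_distrib_left[symmetric] sum.distrib sum_yes_law sum_no_law affinity_def
    by simp
  finally show ?thesis unfolding yes no by (simp add: right_diff_distrib sum_subtractf)
qed

end

section \<open>The hard instances\<close>

text \<open>The vertices come in pairs \<open>2 * i\<close>, \<open>2 * i + 1\<close>, which a hidden cut always separates. Hence every
  hidden cut contains exactly half of these edges, and the density of the planted edges relative to
  the uniform distribution is exactly \<open>1 + cut_sign (side x)\<close>.\<close>

definition hard_edges :: "nat \<Rightarrow> nat set set" where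
  "hard_edges h = (\<lambda>(j, i, a, b). {2 * i + a, 2 * j + b}) ` (SIGMA j:{..<h}. {..<j} \<times> {..<2} \<times> {..<2})"

section \<open>Enumeration of the hard edges\<close>

lemma hard_edge_inj:
  fixes i j a b :: nat
  assumes "{2 * i + a, 2 * j + b} = {2 * i' + a', 2 * j' + b'}" "i < j" "i' < j'" "a < 2" "b < 2" "a' < 2" "b' < 2"
  shows "j = j' \<and> i = i' \<and> a = a' \<and> b = b'"
proof -
  have digit: "k = k' \<and> d = d'" if "2 * k + d = 2 * k' + d'" "d < 2" "d' < 2" for k d k' d' :: nat
    using that by presburger
  \<comment> \<open>Quotient and remainder modulo 2 recover pair and vertex; the conditions
    \<open>i < j\<close> and \<open>i' < j'\<close> exclude the swapped reading of the unordered
    edge.\<close>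
  show ?thesis
    using assms unfolding doubleton_eq_iff by (elim disjE conjE) (auto dest!: digit)
qed

lemma finite_hard_edges [simp]: "finite (hard_edges h)"
  by (simp add: hard_edges_def)

lemma sum_hard_edges:
  fixes F :: "nat set \<Rightarrow> 'a::comm_monoid_add"
  shows "(\<Sum>e\<in>hard_edges h. F e) = (\<Sum>j<h. \<Sum>i<j. \<Sum>a<2. \<Sum>b<2. F {2 * i + a, 2 * j + b})"
proof -
  have "inj_on (\<lambda>(j, i, a, b). {2 * i + a, 2 * j + b}) (SIGMA j:{..<h}. {..<j} \<times> {..<2} \<times> {..<2})"
    by (intro inj_onI) (auto dest!: hard_edge_inj)
  then have "(\<Sum>e\<in>hard_edges h. F e)
     = (\<Sum>(j, i, a, b)\<in>(SIGMA j:{..<h}. {..<j} \<times> {..<2} \<times> {..<2}). F {2 * i + a, 2 * j + b})"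
    unfolding hard_edges_def by (subst sum.reindex) (simp_all add: case_prod_unfold)
  also have "\<dots> = (\<Sum>j<h. \<Sum>(i, a, b)\<in>{..<j} \<times> {..<2} \<times> {..<2}. F {2 * i + a, 2 * j + b})"
    by (subst sum.Sigma) (auto simp: case_prod_unfold)
  finally show ?thesis by (simp add: sum.cartesian_product case_prod_unfold)
qed

lemma card_hard_edges: "real (card (hard_edges h)) = 2 * real h * (real h - 1)"
proof -
  have "real (card (hard_edges h)) = (\<Sum>e\<in>hard_edges h. 1)" by simp
  also have "\<dots> = (\<Sum>j<h. 4 * real j)" unfolding sum_hard_edges by (simp add: mult.commute)
  also have "\<dots> = 2 * real h * (real h - 1)" by (induction h) (auto simp: algebra_simps)
  finally show ?thesis .
qed

lemma hard_edges_subset: "2 * h \<le> n \<Longrightarrow> hard_edges h \<subseteq> edges n"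
proof
  fix e assume n: "2 * h \<le> n" and "e \<in> hard_edges h"
  then obtain j i a b where e: "e = {2 * i + a, 2 * j + b}" "j < h" "i < j" "a < 2" "b < 2"
    by (auto simp: hard_edges_def)
  then have "2 * i + a < n" "2 * j + b < n" "2 * i + a \<noteq> 2 * j + b" using n by linarith+
  then show "e \<in> edges n" unfolding edges_def e(1) by blast
qed

text \<open>For a sign vector \<open>y\<close> this is 1 on edges between the two sides and -1 on
  edges within a side. The product over the set makes it well defined on unordered edges.\<close>

definition cut_sign :: "(nat \<Rightarrow> real) \<Rightarrow> nat set \<Rightarrow> real" where
  "cut_sign y e = - (\<Prod>v\<in>e. y v)"

lemma cut_sign_doubleton: "u \<noteq> v \<Longrightarrow> cut_sign y {u, v} = - (y u * y v)"
  by (simp add: cut_sign_def)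

lemma hard_edge_neq: "i < j \<Longrightarrow> a < 2 \<Longrightarrow> 2 * i + a \<noteq> 2 * j + (b::nat)"
  by linarith

text \<open>The four edges between two vertex pairs contribute a product of the two pair
  sums.\<close>

lemma sum_cut_sign:
  "(\<Sum>e\<in>hard_edges h. cut_sign y e)
     = - (\<Sum>j<h. \<Sum>i<j. (y (2 * i) + y (2 * i + 1)) * (y (2 * j) + y (2 * j + 1)))"
proof -
  have "(\<Sum>a<2. \<Sum>b<2. cut_sign y {2 * i + a, 2 * j + b})
      = - ((y (2 * i) + y (2 * i + 1)) * (y (2 * j) + y (2 * j + 1)))" if "i < j" for i j
  proof -
    have "(\<Sum>a<2. \<Sum>b<2. cut_sign y {2 * i + a, 2 * j + b}) = (\<Sum>a<2. \<Sum>b<2. - (y (2 * i + a) * y (2 * j + b)))"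
      using that by (intro sum.cong refl cut_sign_doubleton hard_edge_neq) auto
    also have "\<dots> = - ((y (2 * i) + y (2 * i + 1)) * (y (2 * j) + y (2 * j + 1)))"
      by (simp add: numeral_2_eq_2 lessThan_Suc algebra_simps)
    finally show ?thesis .
  qed
  then show ?thesis
    unfolding sum_hard_edges sum_negf[symmetric] by (intro sum.cong refl) auto
qed

lemma square_of_sum:
  fixes z :: "nat \<Rightarrow> real"
  shows "(\<Sum>i<h. z i)\<^sup>2 = (\<Sum>i<h. (z i)\<^sup>2) + 2 * (\<Sum>j<h. \<Sum>i<j. z i * z j)"
  by (induction h) (simp_all add: power2_sum sum_distrib_right[symmetric])

text \<open>The sum of all cross products is half of the square of the total minus the sum of
  squares. The former is nonnegative, and each pair sum has square at most 4. Hence every cut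
  contains at most \<open>h\<close> edges more than half of the hard edges.\<close>

lemma sum_cut_sign_le:
  assumes "\<And>v. \<bar>y v\<bar> \<le> 1"
  shows "(\<Sum>e\<in>hard_edges h. cut_sign y e) \<le> 2 * real h"
proof -
  define z where "z i = y (2 * i) + y (2 * i + 1)" for i
  have "(z i)\<^sup>2 \<le> 2\<^sup>2" for i
    using assms[of "2 * i"] assms[of "2 * i + 1"] by (subst abs_le_square_iff[symmetric]) (simp add: z_def)
  then have "(\<Sum>i<h. (z i)\<^sup>2) \<le> (\<Sum>i<h. 2\<^sup>2)" by (intro sum_mono)
  then have "- (\<Sum>j<h. \<Sum>i<j. z i * z j) \<le> 2 * real h"
    using square_of_sum[of z h] zero_le_power2[of "\<Sum>i<h. z i"] by simp
  then show ?thesis by (simp add: sum_cut_sign z_def)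
qed

definition side :: "nat set \<Rightarrow> nat \<Rightarrow> real" where
  "side x v = rad x (v div 2) * (-1) ^ v"

lemma abs_side: "\<bar>side x v\<bar> = 1"
  by (simp add: side_def rad_def abs_mult power_abs)

text \<open>Both vertices of a pair have opposite signs, so every pair sum is zero.\<close>

lemma sum_cut_sign_side: "(\<Sum>e\<in>hard_edges h. cut_sign (side x) e) = 0"
  by (simp add: sum_cut_sign side_def)

lemma cut_sign_pm1:
  assumes "e \<in> edges n" "\<And>v. \<bar>y v\<bar> = 1"
  shows "cut_sign y e = 1 \<or> cut_sign y e = -1"
proof -
  obtain u v where e: "e = {u, v}" "u \<noteq> v" using assms(1) by (auto simp: edges_def)
  have "\<bar>cut_sign y e\<bar> = 1" unfolding e(1) cut_sign_doubleton[OF e(2)] by (simp add: abs_mult assms(2))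
  then show ?thesis by linarith
qed

text \<open>The four edges between two vertex pairs carry the same degree-two coefficient up to
  sign, hence the factor 4.\<close>

lemma sum_square_bias:
  "(\<Sum>e\<in>hard_edges h. (\<Sum>x\<in>X. f x * cut_sign (side x) e)\<^sup>2)
     = 4 * (\<Sum>j<h. \<Sum>i<j. (\<Sum>x\<in>X. f x * rad x i * rad x j)\<^sup>2)"
proof -
  have "(\<Sum>x\<in>X. f x * cut_sign (side x) {2 * i + a, 2 * j + b})\<^sup>2 = (\<Sum>x\<in>X. f x * rad x i * rad x j)\<^sup>2"
    if "i < j" "a < 2" "b < 2" for i j a b
  proof -
    have "cut_sign (side x) {2 * i + a, 2 * j + b} = - ((-1) ^ (a + b)) * (rad x i * rad x j)" for x
      using that by (subst cut_sign_doubleton[OF hard_edge_neq]) (auto simp: side_def power_add)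
    then have "(\<Sum>x\<in>X. f x * cut_sign (side x) {2 * i + a, 2 * j + b})
        = - ((-1) ^ (a + b)) * (\<Sum>x\<in>X. f x * rad x i * rad x j)"
      unfolding sum_distrib_left by (intro sum.cong refl) simp
    then show ?thesis by (simp add: power_mult_distrib power2_eq_square[of "(-1) ^ _"] flip: power_add)
  qed
  then have "(\<Sum>e\<in>hard_edges h. (\<Sum>x\<in>X. f x * cut_sign (side x) e)\<^sup>2)
     = (\<Sum>j<h. \<Sum>i<j. \<Sum>a<2::nat. \<Sum>b<2::nat. (\<Sum>x\<in>X. f x * rad x i * rad x j)\<^sup>2)"
    unfolding sum_hard_edges by (intro sum.cong refl) auto
  then show ?thesis by (simp add: sum_distrib_left)
qed

section \<open>Cut values as sums of signs\<close>

lemma cut_value_cut_sign: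
  assumes "set es \<subseteq> edges n" "P \<union> Q = {..<n}" "P \<inter> Q = {}"
    and y: "\<And>v. v < n \<Longrightarrow> y v = (if v \<in> P then 1 else - 1)"
  shows "2 * real (cut_value (mset es) P Q) = real (length es) + (\<Sum>e\<leftarrow>es. cut_sign y e)"
proof -
  have "cut_sign y e = (if \<exists>p\<in>P. \<exists>q\<in>Q. e = {p, q} then 1 else -1)" if e_edge: "e \<in> edges n" for e
  proof -
    obtain u v where e: "e = {u, v}" "u < n" "v < n" "u \<noteq> v"
      using e_edge unfolding edges_def by blast
    have "(\<exists>p\<in>P. \<exists>q\<in>Q. e = {p, q}) \<longleftrightarrow> (u \<in> P \<and> v \<in> Q) \<or> (v \<in> P \<and> u \<in> Q)"
      unfolding e(1) doubleton_eq_iff by blast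
    moreover have "u \<in> Q \<longleftrightarrow> u \<notin> P" "v \<in> Q \<longleftrightarrow> v \<notin> P"
      using assms(2,3) e(2,3) by blast+
    ultimately show ?thesis using e y by (auto simp: cut_sign_doubleton)
  qed
  with assms(1) show ?thesis
    by (induction es) (auto simp: cut_value_def)
qed

lemma finite_cut_values: "finite {cut_value E P Q |P Q. P \<union> Q = {..<n} \<and> P \<inter> Q = {}}"
proof (rule finite_subset)
  show "{cut_value E P Q |P Q. P \<union> Q = {..<n} \<and> P \<inter> Q = {}}
      \<subseteq> (\<lambda>(P, Q). cut_value E P Q) ` (Pow {..<n} \<times> Pow {..<n})" by force
qed simp

lemma cut_value_le_max_cut: "P \<union> Q = {..<n} \<Longrightarrow> P \<inter> Q = {} \<Longrightarrow> cut_value E P Q \<le> max_cut n E"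
  unfolding max_cut_def by (rule Max_ge[OF finite_cut_values]) blast

lemma max_cut_attained: "\<exists>P Q. P \<union> Q = {..<n} \<and> P \<inter> Q = {} \<and> max_cut n E = cut_value E P Q"
proof -
  have "cut_value E {..<n} {} \<in> {cut_value E P Q |P Q. P \<union> Q = {..<n} \<and> P \<inter> Q = {}}"
    by (intro CollectI exI conjI) (rule refl | simp)+
  then have "max_cut n E \<in> {cut_value E P Q |P Q. P \<union> Q = {..<n} \<and> P \<inter> Q = {}}"
    unfolding max_cut_def by (intro Max_in[OF finite_cut_values]) blast
  then show ?thesis by blast
qed

lemma max_cut_side_ge:
  assumes "set es \<subseteq> edges n" "\<And>e. e \<in> set es \<Longrightarrow> cut_sign (side x) e = 1"
  shows "length es \<le> max_cut n (mset es)"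
proof -
  define P where "P = {v. v < n \<and> side x v = 1}"
  have "(\<Sum>e\<leftarrow>es. cut_sign (side x) e) = (\<Sum>e\<leftarrow>es. 1)"
    using assms(2) by (intro arg_cong[where f = sum_list] map_cong) auto
  moreover have "side x v = (if v \<in> P then 1 else -1)" if "v < n" for v
    using abs_side[of x v] that by (auto simp: P_def)
  then have "2 * real (cut_value (mset es) P ({..<n} - P)) = real (length es) + (\<Sum>e\<leftarrow>es. cut_sign (side x) e)"
    using assms(1) by (intro cut_value_cut_sign[where n = n]) (auto simp: P_def)
  ultimately have "length es = cut_value (mset es) P ({..<n} - P)" by (simp add: sum_list_triv)
  also have "\<dots> \<le> max_cut n (mset es)" by (intro cut_value_le_max_cut) (auto simp: P_def)
  finally show ?thesis .
qed

section \<open>Concentration of cut values on uniform streams\<close>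

lemma exp_sign_le:
  fixes l c :: real
  assumes "0 \<le> l" "l \<le> 1" "c = 1 \<or> c = -1"
  shows "exp (l * c) \<le> 1 + l * c + l\<^sup>2"
  using assms(3)
proof
  assume "c = -1"
  \<comment> \<open>The factorisation of 1 + l^3 with 1 + l <= exp l bounds exp (-l) by 1 - l +
    l^2.\<close>
  have "1 \<le> 1 + l ^ 3" using assms by simp
  also have "\<dots> = (1 - l + l\<^sup>2) * (1 + l)" by (simp add: algebra_simps power2_eq_square power3_eq_cube)
  also have "\<dots> \<le> (1 - l + l\<^sup>2) * exp l"
    using assms zero_le_power2[of l] by (intro mult_left_mono exp_ge_add_one_self) linarith+
  finally show ?thesis using \<open>c = -1\<close> by (simp add: exp_minus field_simps)
qed (use assms exp_bound[of l] in simp)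

lemma exp_sum_list: "exp (\<Sum>e\<leftarrow>es. l * f e :: real) = (\<Prod>e\<leftarrow>es. exp (l * f e))"
  by (induction es) (simp_all add: exp_add)

text \<open>Chernoff's method in counting form. A uniform hard edge has mean sign at most
  \<open>1 / (real h - 1)\<close>, hence at most \<open>\<delta>\<close>, while the threshold is
  twice that.\<close>

lemma card_large_cut_le:
  assumes y: "\<And>v. \<bar>y v\<bar> = 1" and h: "h \<ge> 2" "1 / (real h - 1) \<le> \<delta>" and \<delta>: "0 < \<delta>" "\<delta> \<le> 1"
  shows "real (card {es \<in> words (hard_edges h) m. 2 * \<delta> * real m < (\<Sum>e\<leftarrow>es. cut_sign y e)})
     \<le> real (card (hard_edges h)) ^ m * exp (- (real m * \<delta>\<^sup>2 / 4))"
proof -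
  let ?S = "hard_edges h" and ?B = "{es \<in> words (hard_edges h) m. 2 * \<delta> * real m < (\<Sum>e\<leftarrow>es. cut_sign y e)}"
  \<comment> \<open>This value minimises the exponent l^2 - l \<delta> per letter.\<close>
  define l where "l = \<delta> / 2"
  have l: "0 \<le> l" "l \<le> 1" using \<delta> by (auto simp: l_def)
  have "card ?B * exp (l * (2 * \<delta> * m)) = (\<Sum>es\<in>?B. exp (l * (2 * \<delta> * m)))" by simp
  also have "\<dots> \<le> (\<Sum>es\<in>?B. exp (l * (\<Sum>e\<leftarrow>es. cut_sign y e)))"
    using l by (intro sum_mono) (auto intro!: mult_left_mono)
  also have "\<dots> \<le> (\<Sum>es\<in>words ?S m. exp (l * (\<Sum>e\<leftarrow>es. cut_sign y e)))"
    by (intro sum_mono2) auto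
  also have "\<dots> = (\<Sum>es\<in>words ?S m. prod_list (map (\<lambda>e. exp (l * cut_sign y e)) es))"
    by (simp add: exp_sum_list sum_list_const_mult[symmetric])
  also have "\<dots> = (\<Sum>e\<in>?S. exp (l * cut_sign y e)) ^ m" by (rule sum_words_prod_list)
  also have "\<dots> \<le> (card ?S * exp (l * \<delta> + l\<^sup>2)) ^ m"
  proof (intro power_mono sum_nonneg)
    have "(\<Sum>e\<in>?S. exp (l * cut_sign y e)) \<le> (\<Sum>e\<in>?S. 1 + l * cut_sign y e + l\<^sup>2)"
      using hard_edges_subset[of h "2 * h"] y l by (intro sum_mono exp_sign_le cut_sign_pm1) auto
    also have "\<dots> = card ?S * (1 + l\<^sup>2) + l * (\<Sum>e\<in>?S. cut_sign y e)"
      by (simp add: sum.distrib sum_distrib_left algebra_simps)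
    also have "\<dots> \<le> card ?S * (1 + l\<^sup>2) + l * (2 * real h)"
      using l y by (intro add_left_mono mult_left_mono sum_cut_sign_le) (auto intro: order_eq_refl)
    also have "2 * real h = card ?S * (1 / (real h - 1))"
      using h by (simp add: card_hard_edges)
    also have "card ?S * (1 + l\<^sup>2) + l * \<dots> \<le> card ?S * (1 + l\<^sup>2) + l * (card ?S * \<delta>)"
      using h l by (intro add_left_mono mult_left_mono) auto
    also have "\<dots> = card ?S * (1 + (l * \<delta> + l\<^sup>2))" by (simp add: algebra_simps)
    also have "\<dots> \<le> card ?S * exp (l * \<delta> + l\<^sup>2)"
      by (intro mult_left_mono exp_ge_add_one_self) auto
    finally show "(\<Sum>e\<in>?S. exp (l * cut_sign y e)) \<le> card ?S * exp (l * \<delta> + l\<^sup>2)" .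
  qed auto
  also have "\<dots> = card ?S ^ m * exp (m * (l * \<delta> + l\<^sup>2))"
    by (simp add: power_mult_distrib exp_of_nat_mult)
  finally have "card ?B \<le> card ?S ^ m * exp (m * (l * \<delta> + l\<^sup>2)) / exp (l * (2 * \<delta> * m))"
    by (simp add: field_simps)
  also have "\<dots> = card ?S ^ m * exp (m * (l * \<delta> + l\<^sup>2) - l * (2 * \<delta> * m))"
    by (simp add: exp_diff)
  also have "m * (l * \<delta> + l\<^sup>2) - l * (2 * \<delta> * m) = - (real m * \<delta>\<^sup>2 / 4)"
    by (simp add: l_def power2_eq_square algebra_simps)
  finally show ?thesis by simp
qed

text \<open>Union bound over the 2^n possible sides; a cut fraction 1/2 + \<delta> corresponds to a
  mean sign 2 \<delta>.\<close>

lemma card_large_max_cut_le: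
  assumes n: "2 * h \<le> n" and h: "h \<ge> 2" "1 / (real h - 1) \<le> \<delta>" and \<delta>: "0 < \<delta>" "\<delta> \<le> 1"
  shows "real (card {es \<in> words (hard_edges h) m. (1 / 2 + \<delta>) * real m < max_cut n (mset es)})
     \<le> 2 ^ n * (real (card (hard_edges h)) ^ m * exp (- (real m * \<delta>\<^sup>2 / 4)))"
proof -
  define y :: "nat set \<Rightarrow> nat \<Rightarrow> real" where "y P v = (if v \<in> P then 1 else -1)" for P v
  define B where "B P = {es \<in> words (hard_edges h) m. 2 * \<delta> * real m < (\<Sum>e\<leftarrow>es. cut_sign (y P) e)}" for P
  have sub: "{es \<in> words (hard_edges h) m. (1 / 2 + \<delta>) * real m < max_cut n (mset es)} \<subseteq> (\<Union>P\<in>Pow {..<n}. B P)"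
  proof
    fix es assume "es \<in> {es \<in> words (hard_edges h) m. (1 / 2 + \<delta>) * real m < max_cut n (mset es)}"
    then have es: "es \<in> words (hard_edges h) m" and large: "(1 / 2 + \<delta>) * real m < max_cut n (mset es)"
      by simp_all
    obtain P Q where PQ: "P \<union> Q = {..<n}" "P \<inter> Q = {}" "max_cut n (mset es) = cut_value (mset es) P Q"
      using max_cut_attained[of n "mset es"] by auto
    have "set es \<subseteq> edges n" using es hard_edges_subset[OF n] by (auto simp: words_def)
    then have "2 * real (cut_value (mset es) P Q) = real (length es) + (\<Sum>e\<leftarrow>es. cut_sign (y P) e)"
      using PQ by (intro cut_value_cut_sign[where n = n]) (auto simp: y_def)
    then have "es \<in> B P" using es large PQ(3) by (simp add: B_def words_def algebra_simps)
    moreover have "P \<subseteq> {..<n}" using PQ by blast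
    ultimately show "es \<in> (\<Union>P\<in>Pow {..<n}. B P)" by blast
  qed
  have "card {es \<in> words (hard_edges h) m. (1 / 2 + \<delta>) * real m < max_cut n (mset es)} \<le> card (\<Union>P\<in>Pow {..<n}. B P)"
    by (intro card_mono sub) (auto simp: B_def)
  also have "\<dots> \<le> (\<Sum>P\<in>Pow {..<n}. card (B P))" by (intro card_UN_le) simp
  finally have "real (card {es \<in> words (hard_edges h) m. (1 / 2 + \<delta>) * real m < max_cut n (mset es)})
      \<le> (\<Sum>P\<in>Pow {..<n}. real (card (B P)))" unfolding of_nat_sum[symmetric] by (rule of_nat_mono)
  also have "\<dots> \<le> (\<Sum>P\<in>Pow {..<n}. real (card (hard_edges h)) ^ m * exp (- (real m * \<delta>\<^sup>2 / 4)))"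
    unfolding B_def by (intro sum_mono card_large_cut_le h \<delta>) (simp add: y_def)
  also have "\<dots> = 2 ^ n * (real (card (hard_edges h)) ^ m * exp (- (real m * \<delta>\<^sup>2 / 4)))"
    by (simp add: card_Pow)
  finally show ?thesis .
qed

section \<open>Averaging over random orders\<close>

lemma prob_bind_pmf: "measure_pmf.prob (bind_pmf p f) X = measure_pmf.expectation p (\<lambda>x. measure_pmf.prob (f x) X)"
  unfolding measure_pmf_bind
  by (rule measure_pmf.measure_bind[where N = "count_space UNIV"]) (simp_all add: measure_pmf_in_subprob_algebra)
lemma prob_pair_pmf_of_set:
  assumes "finite B" "B \<noteq> {}"
  shows "measure_pmf.prob (pair_pmf A (pmf_of_set B)) {(a, b). R a b}
     = (\<Sum>b\<in>B. measure_pmf.prob A {a. R a b}) / card B"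
proof -
  have "pair_pmf A (pmf_of_set B) = bind_pmf (pmf_of_set B) (\<lambda>b. map_pmf (\<lambda>a. (a, b)) A)"
    unfolding pair_pmf_def map_pmf_def by (rule bind_commute_pmf)
  then have "measure_pmf.prob (pair_pmf A (pmf_of_set B)) {(a, b). R a b}
      = measure_pmf.expectation (pmf_of_set B) (\<lambda>b. measure_pmf.prob (map_pmf (\<lambda>a. (a, b)) A) {(a, b). R a b})"
    by (simp only: prob_bind_pmf)
  also have "\<dots> = (\<Sum>b\<in>B. measure_pmf.prob (map_pmf (\<lambda>a. (a, b)) A) {(a, b). R a b}) / card B"
    using assms(2,1) by (rule integral_pmf_of_set)
  also have "\<dots> = (\<Sum>b\<in>B. measure_pmf.prob A {a. R a b}) / card B"
    by (simp add: vimage_def)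
  finally show ?thesis .
qed

text \<open>The words with a given multiset of letters are exactly its arrangements. A uniform word
  is thus in random order given its multiset, and the guarantee can be averaged over these
  blocks.\<close>

lemma sum_words_success_ge:
  assumes A: "approximates_max_cut \<gamma> n m A" and T: "finite T" "T \<subseteq> edges n"
  shows "(\<Sum>es\<in>words T m. measure_pmf.prob A {D. approximates \<gamma> (max_cut n (mset es)) (run D es)})
     \<ge> 99 / 100 * card (words T m)"
proof -
  let ?W = "words T m" and ?G = "\<lambda>E es. measure_pmf.prob A {D. approximates \<gamma> (max_cut n E) (run D es)}"
  have perm: "{es. es \<in> ?W \<and> mset es = E} = permutations_of_multiset E" if "E \<in> mset ` ?W" for E
    using that by (auto simp: permutations_of_multiset_def words_def dest: mset_eq_length mset_eq_setD)
  have block: "(\<Sum>es | es \<in> ?W \<and> mset es = E. ?G (mset es) es) \<ge> (\<Sum>es | es \<in> ?W \<and> mset es = E. 99 / 100)"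
    if E: "E \<in> mset ` ?W" for E
  proof -
    have "E \<in> multigraphs n m" using E T by (auto simp: multigraphs_def words_def)
    then have "99 / 100 \<le> measure_pmf.prob (pair_pmf A (random_order E))
          {(D, es). approximates \<gamma> (real (max_cut n E)) (run D es)}"
      using A by (auto simp: approximates_max_cut_def)
    also have "\<dots> = (\<Sum>es\<in>permutations_of_multiset E. ?G E es) / card (permutations_of_multiset E)"
      unfolding random_order_def by (rule prob_pair_pmf_of_set) auto
    finally have "99 / 100 * card (permutations_of_multiset E) \<le> (\<Sum>es\<in>permutations_of_multiset E. ?G E es)"
      by (simp add: pos_le_divide_eq card_gt_0_iff)
    moreover have "(\<Sum>es | es \<in> ?W \<and> mset es = E. ?G (mset es) es) = (\<Sum>es\<in>permutations_of_multiset E. ?G E es)"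
      unfolding perm[OF E, symmetric] by (intro sum.cong) auto
    ultimately show ?thesis by (simp add: perm[OF E] mult.commute)
  qed
  have "99 / 100 * card ?W = (\<Sum>es\<in>?W. 99 / 100)" by simp
  also have "\<dots> = (\<Sum>E\<in>mset ` ?W. \<Sum>es | es \<in> ?W \<and> mset es = E. 99 / 100)"
    using T by (intro sum.image_gen) simp
  also have "\<dots> \<le> (\<Sum>E\<in>mset ` ?W. \<Sum>es | es \<in> ?W \<and> mset es = E. ?G (mset es) es)"
    by (intro sum_mono block)
  also have "\<dots> = (\<Sum>es\<in>?W. ?G (mset es) es)"
    using T by (intro sum.image_gen[symmetric]) simp
  finally show ?thesis .
qed

text \<open>Fixes the internal randomness: by linearity of expectation, a bound for each
  deterministic algorithm carries over to the mixture, even with coefficients of both signs.\<close>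

lemma sum_prob_le:
  assumes "finite I" and le: "\<And>D. D \<in> set_pmf A \<Longrightarrow> (\<Sum>i\<in>I. c i * of_bool (R D i)) \<le> (K::real)"
  shows "(\<Sum>i\<in>I. c i * measure_pmf.prob A {D. R D i}) \<le> K"
proof -
  have int: "integrable (measure_pmf A) (indicator {D. R D i} :: _ \<Rightarrow> real)" for i
    by (rule measure_pmf.integrable_const_bound[where B = 1]) auto
  have "(\<Sum>i\<in>I. c i * measure_pmf.prob A {D. R D i})
      = measure_pmf.expectation A (\<lambda>D. \<Sum>i\<in>I. c i * indicator {D. R D i} D)"
    using int by (subst Bochner_Integration.integral_sum) auto
  also have "\<dots> \<le> K"
  proof (rule measure_pmf.integral_le_const)
    show "integrable (measure_pmf A) (\<lambda>D. \<Sum>i\<in>I. c i * indicator {D. R D i} D)"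
      by (intro Bochner_Integration.integrable_sum integrable_mult_right int)
    show "AE D in measure_pmf A. (\<Sum>i\<in>I. c i * indicator {D. R D i} D) \<le> K"
      using le by (auto simp: AE_measure_pmf_iff indicator_def of_bool_def)
  qed
  finally show ?thesis .
qed

section \<open>The lower bound\<close>

lemma memory_snoc: "memory D (es @ [e]) = update D (length es) (memory D es) e"
  by (simp add: memory_def enumerate_append_eq)

lemma card_bool_lists_le: "real (card {w :: bool list. length w \<le> s}) \<le> 2 ^ Suc s"
proof -
  have "card {w :: bool list. length w \<le> s} = (\<Sum>i\<le>s. 2 ^ i)"
    using card_lists_length_le[of "UNIV :: bool set" s] by simp
  also have "real \<dots> = 2 ^ Suc s - 1" by (induction s) auto
  finally show ?thesis by simp
qed

lemma finite_bool_lists_le: "finite {w :: bool list. length w \<le> s}"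
  using finite_lists_length_le[of "UNIV :: bool set" s] by simp

text \<open>The affinity bound with threshold 2^-r and at most 2^(s+1) memory states; the level-two
  inequality is applied to the posterior of the hidden cut.\<close>

lemma deterministic_accept_diff_le:
  fixes D :: "nat set stream_alg" and acc :: "bool list \<Rightarrow> bool" and h :: nat
  defines "S \<equiv> hard_edges h" and "X \<equiv> Pow {..<h}"
  assumes n: "2 * h \<le> n" and h: "h \<ge> 2" and r: "r \<ge> 1"
    and space: "\<And>es. set es \<subseteq> edges n \<Longrightarrow> length es \<le> m \<Longrightarrow> length (memory D es) \<le> s"
    and small: "m * (16 * (real r)\<^sup>2 / (real h * (real h - 1)) + sqrt (2 ^ Suc s / 2 ^ r)) \<le> 1 / 16"
  shows "(\<Sum>x\<in>X. \<Sum>es\<in>words S m. of_bool (acc (memory D es))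
            * (\<Prod>e\<leftarrow>es. (1 + cut_sign (side x) e) / card S)) / card X
    - (\<Sum>es\<in>words S m. of_bool (acc (memory D es))) / card S ^ m \<le> 1 / 2"
proof -
  have sub: "S \<subseteq> edges n" unfolding S_def using n by (rule hard_edges_subset)
  have cS: "real (card S) = 2 * real h * (real h - 1)" unfolding S_def by (rule card_hard_edges)
  have pos: "real h * (real h - 1) > 0" using h by simp
  interpret hidden_stream S X "\<lambda>x. cut_sign (side x)" "memory D" "update D"
  proof
    show "S \<noteq> {}" using cS pos by auto
    show "\<bar>cut_sign (side x) e\<bar> \<le> 1" if "e \<in> S" for x e
      using cut_sign_pm1[of e n "side x"] that sub abs_side by force
    show "(\<Sum>e\<in>S. cut_sign (side x) e) = 0" for x
      unfolding S_def by (rule sum_cut_sign_side)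
  qed (auto simp: S_def X_def memory_snoc)
  \<comment> \<open>Four edges per pair times 8 r^2 gives 32 r^2, which equals
    \<open>card S * w\<close>.\<close>
  define w where "w = 16 * (real r)\<^sup>2 / (real h * (real h - 1))"
  have "affinity m \<ge> 1 - m * ((w + sqrt (1 / 2 ^ r * 2 ^ Suc s)) / 2)"
  proof (rule affinity_ge)
    fix t assume t: "t < m"
    have "states t \<subseteq> {w. length w \<le> s}"
      using t sub space by (auto simp: states_def words_def)
    then have "real (card (states t)) \<le> real (card {w :: bool list. length w \<le> s})"
      by (intro of_nat_mono card_mono finite_bool_lists_le)
    also have "\<dots> \<le> 2 ^ Suc s" by (rule card_bool_lists_le)
    finally show "real (card (states t)) \<le> 2 ^ Suc s" .
  next
    fix t \<sigma> assume \<sigma>: "\<sigma> \<in> states t" and p: "1 / 2 ^ r \<le> yes_law t \<sigma>"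
    define f where "f x = law (yes_weight x) t \<sigma> / card X" for x
    have cX: "real (card X) = 2 ^ h" by (simp add: X_def card_Pow)
    have "(\<Sum>j<h. \<Sum>i<j. (\<Sum>x\<in>Pow {..<h}. f x * rad x i * rad x j)\<^sup>2) \<le> 8 * (real r)\<^sup>2 * (yes_law t \<sigma>)\<^sup>2"
    proof (rule level_two_inequality[OF _ _ r _ p])
      show "0 \<le> f x" if "x \<subseteq> {..<h}" for x
        using yes_component_nonneg[of x t \<sigma>] that by (simp add: f_def X_def)
      show "f x \<le> 1 / 2 ^ h" if "x \<subseteq> {..<h}" for x
        using yes_component_le[of x \<sigma> t] \<sigma> that unfolding f_def cX
        by (intro divide_right_mono) (auto simp: X_def)
      show "yes_law t \<sigma> = (\<Sum>x\<in>Pow {..<h}. f x)"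
        unfolding X_def[symmetric] yes_law_def f_def ..
    qed
    moreover have "(\<Sum>e\<in>S. (bias t \<sigma> e)\<^sup>2) = 4 * (\<Sum>j<h. \<Sum>i<j. (\<Sum>x\<in>X. f x * rad x i * rad x j)\<^sup>2)"
      unfolding bias_def f_def[symmetric] unfolding S_def by (rule sum_square_bias)
    ultimately have "(\<Sum>e\<in>S. (bias t \<sigma> e)\<^sup>2) \<le> 4 * (8 * (real r)\<^sup>2 * (yes_law t \<sigma>)\<^sup>2)"
      unfolding X_def[symmetric] by linarith
    also have "\<dots> = card S * w * (yes_law t \<sigma>)\<^sup>2"
      unfolding cS w_def using h by simp
    finally show "(\<Sum>e\<in>S. (bias t \<sigma> e)\<^sup>2) \<le> card S * w * (yes_law t \<sigma>)\<^sup>2" .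
  qed (use pos in \<open>auto simp: w_def\<close>)
  moreover define z where "z = m * ((w + sqrt (1 / 2 ^ r * 2 ^ Suc s)) / 2)"
  \<comment> \<open>The affinity loss is at most 1/32, so the acceptance gap is at most 8/32 + 1/4 =
    1/2.\<close>
  have "2 * z \<le> 1 / 16" using small by (simp add: z_def w_def)
  ultimately have "1 - affinity m \<le> 1 / 32" unfolding z_def[symmetric] by linarith
  moreover have "yes_weight = (\<lambda>x e. (1 + cut_sign (side x) e) / card S)"
    by (simp add: fun_eq_iff yes_weight_def)
  ultimately show ?thesis using accept_diff_le[of acc m] by simp
qed

section \<open>Acceptance by a correct algorithm on planted and on uniform streams\<close>

lemma card_words: "finite S \<Longrightarrow> card (words S t) = card S ^ t"
  unfolding words_def by (rule card_lists_length_eq)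

text \<open>The planted weights are the uniform distribution on words over the cut hard edges
  \<open>T\<close>. There the hidden cut contains all \<open>m\<close> edges, so a correct output is
  at least m / \<gamma>.\<close>

lemma yes_accept_ge:
  assumes A: "approximates_max_cut \<gamma> n m A" and \<gamma>: "\<gamma> > 0" and n: "2 * h \<le> n" and h: "h \<ge> 2"
  defines "S \<equiv> hard_edges h"
  shows "(\<Sum>es\<in>words S m. (\<Prod>e\<leftarrow>es. (1 + cut_sign (side x) e) / card S)
            * measure_pmf.prob A {D. real m / \<gamma> \<le> run D es}) \<ge> 99 / 100"
proof -
  define T where "T = {e \<in> S. cut_sign (side x) e = 1}"
  have sub: "S \<subseteq> edges n" unfolding S_def using n by (rule hard_edges_subset)
  have fin: "finite S" "finite T" by (auto simp: S_def T_def)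
  have pm: "cut_sign (side x) e = (if e \<in> T then 1 else -1)" if "e \<in> S" for e
    using cut_sign_pm1[of e n "side x"] that sub abs_side by (auto simp: T_def)
  have cS: "real (card S) > 0" using h by (simp add: S_def card_hard_edges)
  \<comment> \<open>Since the signs sum to zero, \<open>T\<close> is exactly half of
    \<open>S\<close>; this makes the planted weights sum to one.\<close>
  have "(\<Sum>e\<in>S. 1 + cut_sign (side x) e) = card S"
    by (simp add: sum.distrib sum_cut_sign_side S_def)
  moreover have "(\<Sum>e\<in>S. 1 + cut_sign (side x) e) = (\<Sum>e\<in>S. if e \<in> T then 2 else 0)"
    by (intro sum.cong refl) (simp add: pm)
  moreover have "\<dots> = 2 * card T"
    using fin by (simp add: sum.If_cases T_def Int_def conj_commute)
  ultimately have cT: "real (card S) = 2 * card T" by simp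
  have weight: "(\<Prod>e\<leftarrow>es. (1 + cut_sign (side x) e) / card S) = (if es \<in> words T m then 1 / card (words T m) else 0)"
    if es: "es \<in> words S m" for es
  proof (cases "es \<in> words T m")
    case True
    have "(1 + cut_sign (side x) e) / card S = 1 / card T" if "e \<in> T" for e
      using that cT by (simp add: T_def)
    then have "map (\<lambda>e. (1 + cut_sign (side x) e) / card S) es = replicate m (1 / card T)"
      using True by (intro replicate_eqI) (auto simp: words_def subset_iff)
    then show ?thesis using True by (simp add: prod_list_replicate card_words fin power_divide)
  next
    case False
    then obtain e where "e \<in> set es" "e \<in> S" "e \<notin> T" using es by (auto simp: words_def)
    then have "(1 + cut_sign (side x) e) / card S = 0" "e \<in> set es" by (auto simp: pm)
    then have "(\<Prod>e\<leftarrow>es. (1 + cut_sign (side x) e) / card S) = 0"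
      unfolding prod_list_zero_iff by force
    then show ?thesis using False by simp
  qed
  have good: "measure_pmf.prob A {D. approximates \<gamma> (max_cut n (mset es)) (run D es)}
      \<le> measure_pmf.prob A {D. real m / \<gamma> \<le> run D es}" if "es \<in> words T m" for es
  proof (rule measure_pmf.finite_measure_mono)
    have "m \<le> max_cut n (mset es)"
      using max_cut_side_ge[of es n x] that sub by (auto simp: words_def T_def)
    then have "real m / \<gamma> \<le> max_cut n (mset es) / \<gamma>" using \<gamma> by (intro divide_right_mono) auto
    then show "{D. approximates \<gamma> (max_cut n (mset es)) (run D es)} \<subseteq> {D. real m / \<gamma> \<le> run D es}"
      by (auto simp: approximates_def)
  qed simp
  have cW: "real (card (words T m)) > 0" using cT cS by (simp add: card_words fin)
  have "99 / 100 * card (words T m) \<le> (\<Sum>es\<in>words T m. measure_pmf.prob A {D. approximates \<gamma> (max_cut n (mset es)) (run D es)})"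
    using sum_words_success_ge[OF A fin(2)] sub by (auto simp: T_def)
  also have "\<dots> \<le> (\<Sum>es\<in>words T m. measure_pmf.prob A {D. real m / \<gamma> \<le> run D es})"
    by (intro sum_mono good)
  finally have "99 / 100 \<le> (\<Sum>es\<in>words T m. measure_pmf.prob A {D. real m / \<gamma> \<le> run D es}) / card (words T m)"
    using cW by (simp add: pos_le_divide_eq)
  also have "\<dots> = (\<Sum>es\<in>words T m. 1 / card (words T m) * measure_pmf.prob A {D. real m / \<gamma> \<le> run D es})"
    by (simp add: sum_divide_distrib)
  also have "\<dots> = (\<Sum>es\<in>words S m. (\<Prod>e\<leftarrow>es. (1 + cut_sign (side x) e) / card S)
            * measure_pmf.prob A {D. real m / \<gamma> \<le> run D es})"
  proof (rule sum.mono_neutral_cong_left)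
    show TS: "words T m \<subseteq> words S m" by (auto simp: words_def T_def)
    show "1 / card (words T m) * measure_pmf.prob A {D. real m / \<gamma> \<le> run D es}
        = (\<Prod>e\<leftarrow>es. (1 + cut_sign (side x) e) / card S) * measure_pmf.prob A {D. real m / \<gamma> \<le> run D es}"
      if "es \<in> words T m" for es
      using weight[of es] that TS by auto
  qed (use fin weight in auto)
  finally show ?thesis .
qed

text \<open>An output of at least m / \<gamma> means that the algorithm fails or that the maximum
  cut is unusually large; each event has probability at most 1/100.\<close>

lemma no_accept_le:
  assumes A: "approximates_max_cut \<gamma> n m A" and n: "2 * h \<le> n"
    and h: "h \<ge> 2" "1 / (real h - 1) \<le> \<delta>" and \<delta>: "0 < \<delta>" "\<delta> \<le> 1"
    and gap: "(1 / 2 + \<delta>) * real m < real m / \<gamma>"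
    and rare: "2 ^ n * exp (- (real m * \<delta>\<^sup>2 / 4)) \<le> (1 / 100 :: real)"
  defines "S \<equiv> hard_edges h"
  shows "(\<Sum>es\<in>words S m. measure_pmf.prob A {D. real m / \<gamma> \<le> run D es}) / card S ^ m \<le> 1 / 50"
proof -
  let ?bad = "\<lambda>es. (1 / 2 + \<delta>) * real m < max_cut n (mset es)"
  have fin: "finite S" and sub: "S \<subseteq> edges n"
    unfolding S_def using n by (auto dest: hard_edges_subset)
  have cS: "real (card S) > 0" using h by (simp add: S_def card_hard_edges)
  have pt: "measure_pmf.prob A {D. real m / \<gamma> \<le> run D es}
      \<le> 1 - measure_pmf.prob A {D. approximates \<gamma> (max_cut n (mset es)) (run D es)} + of_bool (?bad es)" for es
  proof (cases "?bad es")
    case True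
    then have "of_bool (?bad es) = (1::real)" by simp
    then show ?thesis
      using measure_pmf.prob_le_1[of A "{D. real m / \<gamma> \<le> run D es}"]
        measure_pmf.prob_le_1[of A "{D. approximates \<gamma> (max_cut n (mset es)) (run D es)}"] by linarith
  next
    case False
    then have "{D. real m / \<gamma> \<le> run D es} \<subseteq> UNIV - {D. approximates \<gamma> (max_cut n (mset es)) (run D es)}"
      using gap by (auto simp: approximates_def)
    then have "measure_pmf.prob A {D. real m / \<gamma> \<le> run D es}
        \<le> measure_pmf.prob A (UNIV - {D. approximates \<gamma> (max_cut n (mset es)) (run D es)})"
      by (intro measure_pmf.finite_measure_mono) auto
    also have "\<dots> = 1 - measure_pmf.prob A {D. approximates \<gamma> (max_cut n (mset es)) (run D es)}"
      using measure_pmf.prob_compl[of "{D. approximates \<gamma> (max_cut n (mset es)) (run D es)}" A] by simp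
    finally show ?thesis using False by simp
  qed
  have "(\<Sum>es\<in>words S m. measure_pmf.prob A {D. real m / \<gamma> \<le> run D es})
      \<le> card (words S m) - (\<Sum>es\<in>words S m. measure_pmf.prob A {D. approximates \<gamma> (max_cut n (mset es)) (run D es)})
        + real (card {es \<in> words S m. ?bad es})"
    using sum_mono[of "words S m", OF pt] fin
    by (simp add: sum.distrib sum_subtractf sum.If_cases of_bool_def Int_def)
  also have "\<dots> \<le> card S ^ m - 99 / 100 * card S ^ m + 2 ^ n * (real (card S) ^ m * exp (- (real m * \<delta>\<^sup>2 / 4)))"
    using sum_words_success_ge[OF A fin sub] card_large_max_cut_le[OF n h \<delta>, of m] fin
    by (simp add: card_words S_def)
  also have "\<dots> \<le> card S ^ m - 99 / 100 * card S ^ m + card S ^ m * (1 / 100)"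
    using mult_left_mono[OF rare, of "card S ^ m"] by (simp add: mult_ac)
  finally show ?thesis using cS by (simp add: field_simps)
qed

text \<open>Otherwise the acceptance gap is at most 1/2 by the affinity bound, but at least 99/100 -
  1/50 by correctness.\<close>

lemma space_lower_bound:
  assumes A: "approximates_max_cut \<gamma> n m A" "uses_space n m s A" and \<gamma>: "\<gamma> > 0"
    and n: "2 * h \<le> n" and h: "h \<ge> 2" "1 / (real h - 1) \<le> \<delta>" and \<delta>: "0 < \<delta>" "\<delta> \<le> 1"
    and gap: "(1 / 2 + \<delta>) * real m < real m / \<gamma>"
    and rare: "2 ^ n * exp (- (real m * \<delta>\<^sup>2 / 4)) \<le> (1 / 100 :: real)" and r: "r \<ge> 1"
  shows "m * (16 * (real r)\<^sup>2 / (real h * (real h - 1)) + sqrt (2 ^ Suc s / 2 ^ r)) > 1 / 16"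
proof (rule ccontr)
  assume "\<not> ?thesis"
  then have small: "m * (16 * (real r)\<^sup>2 / (real h * (real h - 1)) + sqrt (2 ^ Suc s / 2 ^ r)) \<le> 1 / 16" by simp
  define S where "S = hard_edges h"
  define X where "X = Pow {..<h}"
  define G where "G es = measure_pmf.prob A {D. real m / \<gamma> \<le> run D es}" for es
  \<comment> \<open>The difference of the planted and the uniform probability of a stream; the
    acceptance gap is then linear in the acceptance probabilities.\<close>
  define c where "c es = (\<Sum>x\<in>X. \<Prod>e\<leftarrow>es. (1 + cut_sign (side x) e) / card S) / card X - 1 / card S ^ m" for es
  have cX: "real (card X) > 0" by (simp add: X_def card_Pow)
  have sum_c: "(\<Sum>es\<in>words S m. c es * b es)
      = (\<Sum>x\<in>X. \<Sum>es\<in>words S m. b es * (\<Prod>e\<leftarrow>es. (1 + cut_sign (side x) e) / card S)) / card X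
        - (\<Sum>es\<in>words S m. b es) / card S ^ m" for b :: "nat set list \<Rightarrow> real"
  proof -
    have "(\<Sum>es\<in>words S m. c es * b es) = (\<Sum>es\<in>words S m.
        (\<Sum>x\<in>X. b es * (\<Prod>e\<leftarrow>es. (1 + cut_sign (side x) e) / card S)) / card X - b es / card S ^ m)"
      by (intro sum.cong refl) (simp add: c_def right_diff_distrib sum_distrib_left[symmetric] mult.commute)
    also have "\<dots> = (\<Sum>es\<in>words S m. \<Sum>x\<in>X. b es * (\<Prod>e\<leftarrow>es. (1 + cut_sign (side x) e) / card S)) / card X
        - (\<Sum>es\<in>words S m. b es) / card S ^ m"
      by (simp only: sum_subtractf sum_divide_distrib)
    finally show ?thesis by (subst sum.swap)
  qed
  have "(\<Sum>es\<in>words S m. c es * G es) \<le> 1 / 2"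
    unfolding G_def
  proof (rule sum_prob_le)
    fix D assume D: "D \<in> set_pmf A"
    have "(\<Sum>es\<in>words S m. c es * of_bool (real m / \<gamma> \<le> run D es))
       = (\<Sum>x\<in>X. \<Sum>es\<in>words S m. of_bool (real m / \<gamma> \<le> result D (memory D es))
            * (\<Prod>e\<leftarrow>es. (1 + cut_sign (side x) e) / card S)) / card X
         - (\<Sum>es\<in>words S m. of_bool (real m / \<gamma> \<le> result D (memory D es))) / card S ^ m"
      unfolding sum_c run_def ..
    also have "\<dots> \<le> 1 / 2"
      unfolding S_def X_def
      using A(2) D small by (intro deterministic_accept_diff_le[OF n h(1) r]) (auto simp: uses_space_def)
    finally show "(\<Sum>es\<in>words S m. c es * of_bool (real m / \<gamma> \<le> run D es)) \<le> 1 / 2" .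
  qed (simp add: S_def)
  moreover have "(\<Sum>es\<in>words S m. c es * G es)
      = (\<Sum>x\<in>X. \<Sum>es\<in>words S m. (\<Prod>e\<leftarrow>es. (1 + cut_sign (side x) e) / card S) * G es) / card X
        - (\<Sum>es\<in>words S m. G es) / card S ^ m"
    unfolding sum_c by (simp add: mult.commute)
  moreover have "(\<Sum>x\<in>X. \<Sum>es\<in>words S m. (\<Prod>e\<leftarrow>es. (1 + cut_sign (side x) e) / card S) * G es) \<ge> (\<Sum>x\<in>X. 99 / 100)"
    unfolding S_def G_def by (intro sum_mono yes_accept_ge[OF A(1) \<gamma> n h(1)])
  then have "(\<Sum>x\<in>X. \<Sum>es\<in>words S m. (\<Prod>e\<leftarrow>es. (1 + cut_sign (side x) e) / card S) * G es) / card X \<ge> 99 / 100"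
    using cX by (simp add: pos_le_divide_eq mult.commute)
  moreover have "(\<Sum>es\<in>words S m. G es) / card S ^ m \<le> 1 / 50"
    unfolding S_def G_def by (rule no_accept_le[OF A(1) n h \<delta> gap rare])
  ultimately show False by linarith
qed

theorem theorem1:
  fixes \<epsilon> :: real
  assumes "0 < \<epsilon>" and "\<epsilon> \<le> 1"
  shows "\<exists>c>0. \<exists>k N::nat. \<forall>n\<ge>N. \<exists>m. \<forall>A s.
           approximates_max_cut (2 - \<epsilon>) n m A \<and> uses_space n m s A \<longrightarrow>
           real s \<ge> c * sqrt (real n) / ln (real n) ^ k"
proof -
  \<comment> \<open>Chosen so that (1/2 + \<delta>) (2 - \<epsilon>) = 1 - \<epsilon>/4 -
    \<epsilon>^2/8 stays below 1.\<close>
  define \<delta> where "\<delta> = \<epsilon> / 8"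
  have \<delta>: "0 < \<delta>" "\<delta> \<le> 1" using assms by (auto simp: \<delta>_def)
  \<comment> \<open>With m = K h this makes the Chernoff exponent m \<delta>^2 / 4 at least 4 h,
    which beats the union bound over 2^n cuts.\<close>
  define K where "K = nat \<lceil>16 / \<delta>\<^sup>2\<rceil>"
  have K: "real K \<ge> 16 / \<delta>\<^sup>2" unfolding K_def by linarith
  have "\<delta>\<^sup>2 \<le> 1" using \<delta> by (simp add: power_le_one)
  then have "16 / \<delta>\<^sup>2 \<ge> 1" using \<delta> by (simp add: field_simps)
  then have K1: "real K \<ge> 1" using K by linarith
  \<comment> \<open>Makes the part of the first loss that grows with \<open>n\<close> at most n / (4
    K), below the available h - 1 of about n / 2.\<close>
  define c where "c = 1 / (128 * real K)"
  have c: "c > 0" using K1 by (simp add: c_def)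
  \<comment> \<open>The loss from improbable memory states decays exponentially in sqrt n and so
    beats the linear stream length.\<close>
  have "((\<lambda>n::nat. real K * real n * 2 powr ((1 - c * sqrt (real n)) / 2)) \<longlongrightarrow> 0) sequentially"
    using c by real_asymp
  then have "eventually (\<lambda>n::nat. real K * real n * 2 powr ((1 - c * sqrt (real n)) / 2) < 1 / 32) sequentially"
    by (rule order_tendstoD) simp
  then obtain N0 where N0: "\<And>n. n \<ge> N0 \<Longrightarrow> real K * real n * 2 powr ((1 - c * sqrt (real n)) / 2) < 1 / 32"
    by (auto simp: eventually_sequentially)
  \<comment> \<open>\<open>N0\<close> serves the improbable states, 300 makes \<open>h\<close>
    exceed 100, the third bound absorbs the constant part of the first loss, and the last gives
    \<open>1 / (real h - 1) \<le> \<delta>\<close>.\<close>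
  define N where "N = max N0 (max 300 (max (4096 * K + 6) (nat \<lceil>4 / \<delta>\<rceil> + 4)))"
  have main: "real s \<ge> c * sqrt (real n)"
    if nN: "n \<ge> N" and A: "approximates_max_cut (2 - \<epsilon>) n (K * (n div 2)) A" "uses_space n (K * (n div 2)) s A"
    for n A s
  proof (rule ccontr)
    assume "\<not> ?thesis"
    then have s: "real s \<le> c * sqrt n" by simp
    define h where "h = n div 2"
    define m where "m = K * h"
    \<comment> \<open>About twice the assumed bound on \<open>s\<close>, so 2^-r is far below the
      inverse of the number of memory states.\<close>
    define r where "r = nat \<lceil>2 * c * sqrt n\<rceil>"
    have n: "n \<ge> N0" "n \<ge> 300" "real n \<ge> 4096 * real K + 6" "real n \<ge> 4 / \<delta> + 4"
      using nN unfolding N_def by (auto, linarith+)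
    have hn: "2 * h \<le> n" "n \<le> 2 * h + 1" by (auto simp: h_def)
    have h: "h \<ge> 149" "real h - 1 \<ge> real n / 2 - 3 / 2" "real h \<le> real n" using hn n(2) by linarith+
    have sq: "sqrt n > 0" using n by simp
    have r: "r \<ge> 1" "2 * c * sqrt n \<le> real r" "real r \<le> 2 * c * sqrt n + 1"
      using mult_pos_pos[OF c sq] by (auto simp: r_def Suc_le_eq)
    have h\<delta>: "1 / (real h - 1) \<le> \<delta>"
    proof -
      have "1 / \<delta> \<le> real h - 1" using h n(4) by (simp add: field_simps)
      then show ?thesis using \<delta> h by (simp add: field_simps)
    qed
    have m: "real m > 0" using K1 h by (simp add: m_def)
    have "(1 / 2 + \<delta>) * (2 - \<epsilon>) < 1"
    proof -
      have "(1 / 2 + \<delta>) * (2 - \<epsilon>) = 1 - \<epsilon> / 4 - \<epsilon> * \<epsilon> / 8" by (simp add: \<delta>_def field_simps)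
      then show ?thesis using assms mult_pos_pos[of \<epsilon> \<epsilon>] by linarith
    qed
    then have "(1 / 2 + \<delta>) < 1 / (2 - \<epsilon>)" using assms by (simp add: pos_less_divide_eq)
    then have gap: "(1 / 2 + \<delta>) * real m < real m / (2 - \<epsilon>)"
      using mult_strict_right_mono[OF _ m] by fastforce
    have rare: "2 ^ n * exp (- (real m * \<delta>\<^sup>2 / 4)) \<le> (1 / 100 :: real)"
    proof -
      have "real K * \<delta>\<^sup>2 \<ge> 16" using K \<delta> by (simp add: pos_divide_le_eq)
      then have "real h * (real K * \<delta>\<^sup>2) \<ge> real h * 16" by (intro mult_left_mono) auto
      then have "exp (- (real m * \<delta>\<^sup>2 / 4)) \<le> exp (- (4 * real h))" by (simp add: m_def mult_ac)
      moreover have "(2::real) ^ n \<le> exp 1 ^ n" using exp_ge_add_one_self[of 1] by (intro power_mono) auto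
      then have "(2::real) ^ n \<le> exp (real n)" by (simp add: exp_of_nat_mult[symmetric])
      ultimately have "2 ^ n * exp (- (real m * \<delta>\<^sup>2 / 4)) \<le> exp (real n) * exp (- (4 * real h))"
        by (intro mult_mono) auto
      also have "\<dots> = exp (real n - 4 * real h)" by (simp add: exp_diff exp_minus divide_inverse)
      also have "\<dots> \<le> exp (- real h)" using hn h by simp
      also have "\<dots> \<le> 1 / (1 + real h)"
        using exp_ge_add_one_self[of "real h"] by (simp add: exp_minus field_simps)
      also have "\<dots> \<le> 1 / 100" using h by (simp add: field_simps)
      finally show ?thesis .
    qed
    have t1: "m * (16 * (real r)\<^sup>2 / (real h * (real h - 1))) \<le> 1 / 32"
    proof -
      have sq_le: "(z + 1)\<^sup>2 \<le> 2 * z\<^sup>2 + 2" for z :: real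
        using zero_le_power2[of "z - 1"] by (simp add: power2_eq_square algebra_simps)
      have "(real r)\<^sup>2 \<le> (2 * c * sqrt n + 1)\<^sup>2" using r by (intro power_mono) auto
      also have "\<dots> \<le> 2 * (2 * c * sqrt n)\<^sup>2 + 2"
        by (rule sq_le)
      also have "(2 * c * sqrt n)\<^sup>2 = 4 * c\<^sup>2 * n" by (simp add: power_mult_distrib)
      finally have "512 * real K * (real r)\<^sup>2 \<le> 512 * real K * (2 * (4 * c\<^sup>2 * n) + 2)"
        by (intro mult_left_mono) auto
      also have "\<dots> = n / (4 * real K) + 1024 * real K"
        using K1 by (simp add: c_def power2_eq_square field_simps)
      also have "\<dots> \<le> n / 4 + 1024 * real K"
        using K1 by (intro add_right_mono divide_left_mono) auto
      also have "\<dots> \<le> real h - 1" using n(3) h(2) by linarith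
      finally have "512 * real K * (real r)\<^sup>2 \<le> real h - 1" .
      moreover have "m * (16 * (real r)\<^sup>2 / (real h * (real h - 1))) = 16 * real K * (real r)\<^sup>2 / (real h - 1)"
        using h by (simp add: m_def)
      ultimately show ?thesis using h(1) by (simp add: pos_divide_le_eq)
    qed
    have t2: "m * sqrt (2 ^ Suc s / 2 ^ r) \<le> 1 / 32"
    proof -
      have "2 ^ Suc s / 2 ^ r = (2::real) powr (real (Suc s) - real r)"
        by (simp only: powr_diff powr_realpow zero_less_numeral)
      then have "sqrt (2 ^ Suc s / 2 ^ r) = (2 powr (real (Suc s) - real r)) powr (1 / 2)"
        by (simp only: powr_half_sqrt powr_ge_zero)
      also have "\<dots> = 2 powr ((real (Suc s) - real r) / 2)" by (simp add: powr_powr)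
      also have "\<dots> \<le> 2 powr ((1 - c * sqrt n) / 2)" using s r(2) by (intro powr_mono) auto
      finally have "m * sqrt (2 ^ Suc s / 2 ^ r) \<le> (real K * real n) * 2 powr ((1 - c * sqrt n) / 2)"
        using h(3) by (intro mult_mono) (auto simp: m_def intro: mult_left_mono)
      then show ?thesis using N0[OF n(1)] by simp
    qed
    have "m * (16 * (real r)\<^sup>2 / (real h * (real h - 1)) + sqrt (2 ^ Suc s / 2 ^ r)) > 1 / 16"
      using assms h by (intro space_lower_bound[OF A[folded h_def, folded m_def] _ hn(1) _ h\<delta> \<delta> gap rare r(1)]) auto
    then show False using t1 t2 by (simp add: distrib_left)
  qed
  show ?thesis
  \<comment> \<open>The exponent 0 means that no logarithmic factor is lost; the streams have length
    linear in \<open>n\<close>.\<close>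
  proof (rule exI[of _ c], rule conjI[OF c], rule exI[of _ 0], rule exI[of _ N], intro allI impI)
    fix n assume "n \<ge> N"
    then show "\<exists>m. \<forall>A s. approximates_max_cut (2 - \<epsilon>) n m A \<and> uses_space n m s A \<longrightarrow>
           real s \<ge> c * sqrt (real n) / ln (real n) ^ 0"
      using main by (intro exI[of _ "K * (n div 2)"]) auto
  qed
qed

end
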